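(* For integers $n\geq 3$ and $\ell\geq 0$, let $g(n,3,\ell)$ denote the minimum number of edges of a simple graph $G$ of order $n$ with $\lambda_3(G)=\ell$. Then (1) $g(n,3,n-2)=\binom{n}{2}-1$; (2) $g(n,3,n-3)=\binom{n}{2}-\lfloor \frac{n+3}{2}\rfloor$; (3) $g(n,3,1)=n-1$; (4) for $n\geq 11$ and $1\leq \ell\leq n-4$, $g(n,3,\ell)\geq \left\lceil \frac{\ell(\ell+1)}{2\ell+1}\,n\right\rceil$. Moreover, this lower bound is sharp, i.e., there exist $n$ and $\ell$ in this range for which equality holds.
   Context: All graphs are finite, undirected and simple. For $S\subseteq V(G)$ with $|S|\geq 2$, an $S$-tree is a subgraph of $G$ that is a tree containing all vertices of $S$; $\lambda(S)$ is the maximum number of pairwise edge-disjoint $S$-trees in $G$. For $2\leq k\leq n$, the generalized $k$-edge-connectivity is $\lambda_k(G)=\min\{\lambda(S): S\subseteq V(G),\ |S|=k\}$, and $\lambda_k(G)=0$ if $G$ is disconnected. *)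

theory Defs
  imports Complex_Main
begin

text \<open>
  A finite simple undirected graph is a pair of a vertex set \<open>V\<close> and a set \<open>E\<close> of
  two-element subsets of \<open>V\<close>.
\<close>

definition simple_graph :: "'a set \<Rightarrow> 'a set set \<Rightarrow> bool" where
  "simple_graph V E \<longleftrightarrow> finite V \<and> E \<subseteq> {e. e \<subseteq> V \<and> card e = 2}"

definition graph_connected :: "'a set \<Rightarrow> 'a set set \<Rightarrow> bool" where
  "graph_connected V E \<longleftrightarrow> V \<noteq> {} \<and> (\<forall>u\<in>V. \<forall>v\<in>V. (\<lambda>x y. {x, y} \<in> E)\<^sup>*\<^sup>* u v)"

text \<open>A cycle is given by the cyclic sequence of its vertices, without repetition.\<close>

definition graph_cycle :: "'a set set \<Rightarrow> 'a list \<Rightarrow> bool" where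
  "graph_cycle E c \<longleftrightarrow> 3 \<le> length c \<and> distinct c \<and>
     (\<forall>i<length c. {c ! i, c ! (Suc i mod length c)} \<in> E)"

definition graph_tree :: "'a set \<Rightarrow> 'a set set \<Rightarrow> bool" where
  "graph_tree V E \<longleftrightarrow> simple_graph V E \<and> graph_connected V E \<and> (\<nexists>c. graph_cycle E c)"

definition S_trees :: "'a set \<Rightarrow> 'a set set \<Rightarrow> 'a set \<Rightarrow> ('a set \<times> 'a set set) set" where
  "S_trees V E S = {(W, F). W \<subseteq> V \<and> F \<subseteq> E \<and> graph_tree W F \<and> S \<subseteq> W}"

text \<open>
  A family of pairwise edge-disjoint trees may be taken as a set of trees, since for
  \<open>card S \<ge> 2\<close> every \<open>S\<close>-tree has an edge, so that edge-disjoint \<open>S\<close>-trees are distinct.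
\<close>

definition tree_packing_number :: "'a set \<Rightarrow> 'a set set \<Rightarrow> 'a set \<Rightarrow> nat" where
  "tree_packing_number V E S =
     Max {card \<T> |\<T>. \<T> \<subseteq> S_trees V E S \<and> pairwise (\<lambda>T U. snd T \<inter> snd U = {}) \<T>}"

definition gen_edge_connectivity :: "nat \<Rightarrow> 'a set \<Rightarrow> 'a set set \<Rightarrow> nat" where
  "gen_edge_connectivity k V E =
     (if graph_connected V E
      then Min {tree_packing_number V E S |S. S \<subseteq> V \<and> card S = k}
      else 0)"

text \<open>
  Every finite graph is isomorphic to one whose vertices are natural numbers, so the minimum
  over graphs of order \<open>n\<close> is taken over those. It is over a nonempty set whenever
  \<open>n \<ge> 3\<close>, \<open>k = 3\<close> and \<open>l \<le> n - 2\<close>: adding edges one at a time to the empty graph until it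
  is complete raises the connectivity by at most one per step, from \<open>0\<close> to \<open>n - 2\<close>.
\<close>

definition min_size :: "nat \<Rightarrow> nat \<Rightarrow> nat \<Rightarrow> nat" where
  "min_size n k l =
     (LEAST m. \<exists>(V :: nat set) E.
        simple_graph V E \<and> card V = n \<and> gen_edge_connectivity k V E = l \<and> card E = m)"

end

theory Submission
  imports Defs
begin

text \<open>
  Let \<open>\<lambda>\<^sub>3(G) = l\<close>. Every vertex has degree at least \<open>l\<close>, and two vertices of degree \<open>l\<close> are never
  adjacent. Both facts together give every lower bound except \<open>n - 1\<close>, which is connectedness:
  for \<open>l = n - 2\<close> and \<open>l = n - 3\<close> they force the complement to have at most one edge,
  respectively maximum degree two with the vertices of degree two forming a clique; in general the
  vertices of degree \<open>l\<close> form an independent set, and counting the edges that meet it and the degree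
  sum gives \<open>(2l + 1) |E| \<ge> l (l + 1) n\<close>.

  The extremal graphs are complete multipartite: \<open>K\<^sub>n\<close> minus an edge, the complement of a triangle
  and a near-perfect matching, the star, and \<open>K\<^sub>5\<^sub>,\<^sub>6\<close>. In such a graph every vertex whose class
  misses \<open>S\<close> is the centre of a star on \<open>S\<close>, so only the few remaining trees have to be given by
  hand. Deleting an edge lowers \<open>\<lambda>\<^sub>3\<close> by at most one, so every value up to \<open>n - 2\<close> is attained and
  the minimum in the general lower bound is over a nonempty set.
\<close>

section \<open>Cuts, trees and packings\<close>

definition all_pairs :: "'a set \<Rightarrow> 'a set set" where
  "all_pairs V = {e. e \<subseteq> V \<and> card e = 2}"

definition degree :: "'a set set \<Rightarrow> 'a \<Rightarrow> nat" where
  "degree E v = card {e \<in> E. v \<in> e}"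

text \<open>
  Connectivity is expressed by cuts, so that for explicit edge sets it is a propositional fact.
\<close>

definition edge_closed :: "'a set set \<Rightarrow> 'a set \<Rightarrow> bool" where
  "edge_closed F X \<longleftrightarrow> (\<forall>e\<in>F. e \<subseteq> X \<or> e \<inter> X = {})"

definition edge_connects :: "'a set set \<Rightarrow> 'a set \<Rightarrow> bool" where
  "edge_connects F S \<longleftrightarrow> (\<forall>X. edge_closed F X \<longrightarrow> S \<subseteq> X \<or> S \<inter> X = {})"

lemma simple_graph_iff: "simple_graph V E \<longleftrightarrow> finite V \<and> E \<subseteq> all_pairs V"
  by (simp add: simple_graph_def all_pairs_def)

lemma finite_all_pairs: "finite V \<Longrightarrow> finite (all_pairs V)"
  unfolding all_pairs_def by simp

lemma card_all_pairs: "finite V \<Longrightarrow> card (all_pairs V) = card V choose 2"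
  unfolding all_pairs_def by (rule n_subsets)

lemma pair_in_all_pairs_iff: "{u, v} \<in> all_pairs V \<longleftrightarrow> u \<in> V \<and> v \<in> V \<and> u \<noteq> v"
  by (auto simp: all_pairs_def card_2_iff)

lemma all_pairsE:
  assumes "e \<in> all_pairs V"
  obtains u v where "e = {u, v}" "u \<in> V" "v \<in> V" "u \<noteq> v"
  using assms by (auto simp: all_pairs_def card_2_iff)

lemma simple_graph_finite_edges: "simple_graph V E \<Longrightarrow> finite E"
  by (meson simple_graph_iff finite_all_pairs finite_subset)

lemma edge_connectsD:
  "edge_connects F S \<Longrightarrow> edge_closed F X \<Longrightarrow> u \<in> S \<Longrightarrow> u \<in> X \<Longrightarrow> v \<in> S \<Longrightarrow> v \<in> X"
  unfolding edge_connects_def by blast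

text \<open>No edge of \<open>F\<close> leaves the set reachable from \<open>u\<close>, since
  adjacency is symmetric; that set is a cut, and it cannot separate \<open>v\<close> from
  \<open>u\<close>.\<close>

lemma edge_connects_reachable:
  assumes F: "F \<subseteq> all_pairs V" and "edge_connects F S" "u \<in> S" "v \<in> S"
  shows "(\<lambda>x y. {x, y} \<in> F)\<^sup>*\<^sup>* u v"
proof -
  let ?R = "\<lambda>x y. {x, y} \<in> F"
  have "edge_closed F {y. ?R\<^sup>*\<^sup>* u y}"
    unfolding edge_closed_def
  proof
    fix e assume e: "e \<in> F"
    then obtain x y where xy: "e = {x, y}" using F by (meson all_pairsE subsetD)
    have "?R x y" "?R y x" using e xy by (auto simp: insert_commute)
    then show "e \<subseteq> {y. ?R\<^sup>*\<^sup>* u y} \<or> e \<inter> {y. ?R\<^sup>*\<^sup>* u y} = {}"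
      using xy by (auto intro: rtranclp.rtrancl_into_rtrancl)
  qed
  from edge_connectsD[OF assms(2) this assms(3) _ assms(4)] show ?thesis by simp
qed

lemma reachable_in_edge_closed:
  assumes "(\<lambda>x y. {x, y} \<in> F)\<^sup>*\<^sup>* u v" "edge_closed F X" "u \<in> X"
  shows "v \<in> X"
  using assms by (induction) (auto simp: edge_closed_def)

lemma graph_connected_iff:
  assumes "F \<subseteq> all_pairs V"
  shows "graph_connected W F \<longleftrightarrow> W \<noteq> {} \<and> edge_connects F W"
proof
  assume c: "graph_connected W F"
  have "W \<subseteq> X \<or> W \<inter> X = {}" if "edge_closed F X" for X
    using c that reachable_in_edge_closed[of F _ _ X] unfolding graph_connected_def by blast
  then show "W \<noteq> {} \<and> edge_connects F W"
    using c by (auto simp: graph_connected_def edge_connects_def)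
next
  assume "W \<noteq> {} \<and> edge_connects F W"
  then show "graph_connected W F"
    using edge_connects_reachable[OF assms] by (auto simp: graph_connected_def)
qed

lemma edge_connects_subset: "edge_connects F W \<Longrightarrow> S \<subseteq> W \<Longrightarrow> edge_connects F S"
  unfolding edge_connects_def by blast

lemma edge_connects_mono: "edge_connects F S \<Longrightarrow> F \<subseteq> F' \<Longrightarrow> edge_connects F' S"
  unfolding edge_connects_def edge_closed_def by blast

text \<open>The rest of the cycle still joins both ends of the removed edge, so a set closed under
  \<open>F - {e}\<close> is closed under \<open>F\<close> as well.\<close>

lemma edge_connects_remove_cycle_edge:
  assumes cyc: "graph_cycle F c" and conn: "edge_connects F S"
  obtains e where "e \<in> F" "edge_connects (F - {e}) S"
proof
  define k where "k = length c"
  \<comment> \<open>The closing edge is removed, so that the remaining edges of the cycle join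
    consecutive list entries.\<close>
  define e where "e = {c ! (k - 1), c ! 0}"
  have k: "3 \<le> k" and d: "distinct c" and ed: "\<And>i. i < k \<Longrightarrow> {c ! i, c ! (Suc i mod k)} \<in> F"
    using cyc by (auto simp: graph_cycle_def k_def)
  have "Suc (k - 1) mod k = 0" using k by simp
  then show "e \<in> F" using ed[of "k - 1"] k by (simp add: e_def)
  have ed': "{c ! i, c ! Suc i} \<in> F - {e}" if i: "Suc i < k" for i
  proof -
    have "{c ! i, c ! Suc i} \<noteq> e"
    proof
      assume "{c ! i, c ! Suc i} = e"
      then have "c ! i = c ! (k - 1) \<or> c ! i = c ! 0 \<and> c ! Suc i = c ! (k - 1)"
        by (auto simp: e_def doubleton_eq_iff)
      then have "i = k - 1 \<or> i = 0 \<and> Suc i = k - 1"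
        using nth_eq_iff_index_eq[OF d, folded k_def] i k by (metis Suc_lessD diff_less zero_less_numeral
          less_le_trans zero_less_one)
      \<comment> \<open>The second alternative would make the cycle have length two.\<close>
      then show False using i k by auto
    qed
    then show ?thesis using ed[of i] i by simp
  qed
  show "edge_connects (F - {e}) S"
    unfolding edge_connects_def
  proof (intro allI impI)
    fix Y assume Y: "edge_closed (F - {e}) Y"
    have "c ! i \<in> Y \<longleftrightarrow> c ! 0 \<in> Y" if "i < k" for i
      using that
    proof (induction i)
      case (Suc i)
      have "{c ! i, c ! Suc i} \<subseteq> Y \<or> {c ! i, c ! Suc i} \<inter> Y = {}"
        using Y ed'[OF Suc.prems] unfolding edge_closed_def by (rule bspec)
      then show ?case using Suc by auto
    qed simp
    from this[of "k - 1"] k have "e \<subseteq> Y \<or> e \<inter> Y = {}" by (auto simp: e_def)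
    with Y have "edge_closed F Y" unfolding edge_closed_def by blast
    then show "S \<subseteq> Y \<or> S \<inter> Y = {}" using conn unfolding edge_connects_def by blast
  qed
qed

text \<open>A least edge set \<open>A\<close> within \<open>F\<close> that connects \<open>S\<close>
  has no cycle and no edge away from the component of \<open>S\<close>, so it spans a tree. Packings
  can therefore be given by connecting edge sets instead of trees.\<close>

lemma edge_connects_imp_tree:
  assumes V: "finite V" and F: "F \<subseteq> all_pairs V" and conn: "edge_connects F S"
    and S: "S \<subseteq> V" "S \<noteq> {}"
  obtains W F' where "W \<subseteq> V" "F' \<subseteq> F" "graph_tree W F'" "S \<subseteq> W"
proof -
  let ?P = "\<lambda>A. A \<subseteq> F \<and> edge_connects A S"
  have finF: "finite F" using F V finite_all_pairs finite_subset by blast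
  obtain A where A: "?P A" and least: "\<And>B. ?P B \<Longrightarrow> card A \<le> card B"
    using conn ex_has_least_nat[of ?P F card] by blast
  have minimal: "\<not> edge_connects (A - {e}) S" if "e \<in> A" for e
  proof
    assume "edge_connects (A - {e}) S"
    then have "card A \<le> card (A - {e})" using A by (intro least) auto
    moreover have "finite A" using A finF finite_subset by blast
    ultimately show False using that by (metis card_Diff1_less not_le)
  qed
  define W where "W = S \<union> \<Union>A"
  have AV: "A \<subseteq> all_pairs V" using A F by blast
  have noncross: "W \<subseteq> X" if X: "edge_closed A X" and SX: "S \<subseteq> X" for X
  proof (rule ccontr)
    assume "\<not> W \<subseteq> X"
    then obtain e where e: "e \<in> A" "\<not> e \<subseteq> X" using SX by (auto simp: W_def)
    have eX: "e \<inter> X = {}" using e X by (auto simp: edge_closed_def)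
    have "edge_connects (A - {e}) S"
      unfolding edge_connects_def
    proof (intro allI impI)
      fix Y assume Y: "edge_closed (A - {e}) Y"
      have "edge_closed A (X \<inter> Y)"
        unfolding edge_closed_def
      proof
        fix f assume f: "f \<in> A"
        show "f \<subseteq> X \<inter> Y \<or> f \<inter> (X \<inter> Y) = {}"
          using X Y f eX unfolding edge_closed_def by (cases "f = e") blast+
      qed
      then have "S \<subseteq> X \<inter> Y \<or> S \<inter> (X \<inter> Y) = {}" using A unfolding edge_connects_def by blast
      then show "S \<subseteq> Y \<or> S \<inter> Y = {}" using SX by blast
    qed
    with minimal e show False by blast
  qed
  have "edge_connects A W"
    unfolding edge_connects_def
  proof (intro allI impI)
    fix X assume X: "edge_closed A X"
    \<comment> \<open>Complements of closed sets are closed, so \<open>noncross\<close> applies to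
      whichever side contains \<open>S\<close>.\<close>
    then have X': "edge_closed A (- X)" unfolding edge_closed_def by blast
    have "S \<subseteq> X \<or> S \<subseteq> - X" using A X unfolding edge_connects_def by blast
    then show "W \<subseteq> X \<or> W \<inter> X = {}" using noncross[OF X] noncross[OF X'] by blast
  qed
  then have "graph_connected W A" using graph_connected_iff[OF AV] S by (auto simp: W_def)
  moreover have WV: "W \<subseteq> V" using S AV by (auto simp: W_def all_pairs_def)
  moreover have "simple_graph W A"
    using AV WV V by (auto simp: simple_graph_def all_pairs_def W_def intro: finite_subset)
  moreover have "\<nexists>c. graph_cycle A c"
    using edge_connects_remove_cycle_edge minimal A by metis
  ultimately show thesis using that[of W A] A by (auto simp: graph_tree_def W_def)
qed

section \<open>Packings of edge-disjoint trees\<close>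

lemma S_treesD:
  assumes "T \<in> S_trees V E S"
  shows "snd T \<subseteq> E" "edge_connects (snd T) S"
proof -
  obtain W F where T: "T = (W, F)" "F \<subseteq> E" "graph_tree W F" "S \<subseteq> W"
    using assms by (auto simp: S_trees_def)
  then have "edge_connects F W"
    using graph_connected_iff[of F W W] by (auto simp: graph_tree_def simple_graph_iff)
  with T show "snd T \<subseteq> E" "edge_connects (snd T) S" by (auto intro: edge_connects_subset)
qed

lemma edge_connects_edge_at:
  assumes "edge_connects F S" "v \<in> S" "w \<in> S" "v \<noteq> w"
  obtains e where "e \<in> F" "v \<in> e"
proof -
  have "\<not> edge_closed F {v}" using edge_connectsD[OF assms(1) _ assms(2) _ assms(3)] assms by auto
  then show thesis using that by (auto simp: edge_closed_def)
qed

lemma finite_S_trees: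
  assumes "simple_graph V E"
  shows "finite (S_trees V E S)"
proof (rule finite_subset)
  show "S_trees V E S \<subseteq> Pow V \<times> Pow E" by (auto simp: S_trees_def)
  show "finite (Pow V \<times> Pow E)"
    using assms simple_graph_finite_edges by (auto simp: simple_graph_def)
qed

lemma tree_packing_number_eq_Max_image:
  "tree_packing_number V E S =
     Max (card ` {\<T>. \<T> \<subseteq> S_trees V E S \<and> pairwise (\<lambda>T U. snd T \<inter> snd U = {}) \<T>})"
  unfolding tree_packing_number_def by (rule arg_cong[of _ _ Max]) auto

lemma finite_packing_family:
  assumes "simple_graph V E"
  shows "finite {\<T>. \<T> \<subseteq> S_trees V E S \<and> pairwise (\<lambda>T U. snd T \<inter> snd U = {}) \<T>}"
  using finite_S_trees[OF assms] by (rule finite_subset[rotated, OF finite_Pow_iff[THEN iffD2]]) auto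

lemma card_le_tree_packing_number:
  assumes "simple_graph V E" "\<T> \<subseteq> S_trees V E S" "pairwise (\<lambda>T U. snd T \<inter> snd U = {}) \<T>"
  shows "card \<T> \<le> tree_packing_number V E S"
  unfolding tree_packing_number_eq_Max_image
  using assms finite_packing_family[OF assms(1)] by (intro Max_ge) auto

lemma tree_packing_number_attained:
  assumes "simple_graph V E"
  obtains \<T> where "\<T> \<subseteq> S_trees V E S" "pairwise (\<lambda>T U. snd T \<inter> snd U = {}) \<T>"
    "finite \<T>" "card \<T> = tree_packing_number V E S"
proof -
  let ?A = "{\<T>. \<T> \<subseteq> S_trees V E S \<and> pairwise (\<lambda>T U. snd T \<inter> snd U = {}) \<T>}"
  have "{} \<in> ?A" by simp
  then have "Max (card ` ?A) \<in> card ` ?A"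
    using finite_packing_family[OF assms] by (intro Max_in) blast+
  then obtain \<T> where "\<T> \<in> ?A" "card \<T> = tree_packing_number V E S"
    unfolding tree_packing_number_eq_Max_image[symmetric] by force
  with that finite_S_trees[OF assms] finite_subset show thesis by blast
qed

text \<open>Each member of the list is trimmed to a tree inside it. The trees have edges because
  \<open>S\<close> has two vertices, so disjointness makes them distinct and their number is the
  length of the list. A list lets explicit packings be checked by simplification.\<close>

lemma length_le_tree_packing_number:
  assumes G: "simple_graph V E" and S: "S \<subseteq> V" "2 \<le> card S"
    and disj: "sorted_wrt (\<lambda>A B. A \<inter> B = {}) Fs"
    and Fs: "\<And>F. F \<in> set Fs \<Longrightarrow> F \<subseteq> E \<and> edge_connects F S"
  shows "length Fs \<le> tree_packing_number V E S"
proof -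
  have V: "finite V" and E: "E \<subseteq> all_pairs V" using G by (auto simp: simple_graph_iff)
  have "\<exists>T. T \<in> S_trees V E S \<and> snd T \<subseteq> F" if "F \<in> set Fs" for F
  proof -
    have "F \<subseteq> all_pairs V" "edge_connects F S" "S \<noteq> {}" using Fs[OF that] E S by auto
    then obtain W F' where "W \<subseteq> V" "F' \<subseteq> F" "graph_tree W F'" "S \<subseteq> W"
      using edge_connects_imp_tree[OF V] S by metis
    then show ?thesis using Fs[OF that] by (intro exI[of _ "(W, F')"]) (auto simp: S_trees_def)
  qed
  then obtain t where t: "\<And>F. F \<in> set Fs \<Longrightarrow> t F \<in> S_trees V E S \<and> snd (t F) \<subseteq> F"
    by metis
  obtain v w where vw: "v \<in> S" "w \<in> S" "v \<noteq> w"
    using obtain_subset_with_card_n[OF S(2)] unfolding card_2_iff by (metis insert_subset)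
  have ne: "snd (t F) \<noteq> {}" if "F \<in> set Fs" for F
    using edge_connects_edge_at[OF S_treesD(2) vw] t[OF that] by blast
  have d: "snd (t (Fs ! i)) \<inter> snd (t (Fs ! j)) = {}" if "i < j" "j < length Fs" for i j
  proof -
    have "Fs ! i \<inter> Fs ! j = {}" using disj that by (simp add: sorted_wrt_iff_nth_less)
    moreover have "Fs ! i \<in> set Fs" "Fs ! j \<in> set Fs" using that by auto
    ultimately show ?thesis using t by blast
  qed
  have d': "snd (t (Fs ! i)) \<inter> snd (t (Fs ! j)) = {}"
    if "i \<noteq> j" "i < length Fs" "j < length Fs" for i j
    using d[of i j] d[of j i] that by (cases "i < j") auto
  have "distinct (map t Fs)"
    unfolding distinct_conv_nth
  proof (intro allI impI)
    fix i j assume "i < length (map t Fs)" "j < length (map t Fs)" "i \<noteq> j"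
    then show "map t Fs ! i \<noteq> map t Fs ! j" using d'[of i j] ne[of "Fs ! i"] by auto
  qed
  then have "length Fs = card (t ` set Fs)" by (metis distinct_card length_map set_map)
  also have "\<dots> \<le> tree_packing_number V E S"
  proof (rule card_le_tree_packing_number[OF G])
    show "t ` set Fs \<subseteq> S_trees V E S" using t by auto
    show "pairwise (\<lambda>T U. snd T \<inter> snd U = {}) (t ` set Fs)"
    proof (rule pairwiseI)
      fix T U assume TU: "T \<in> t ` set Fs" "U \<in> t ` set Fs" "T \<noteq> U"
      then obtain i j where "i < length Fs" "j < length Fs" "T = t (Fs ! i)" "U = t (Fs ! j)"
        by (auto simp: in_set_conv_nth)
      with d'[of i j] TU(3) show "snd T \<inter> snd U = {}" by auto
    qed
  qed
  finally show ?thesis .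
qed

text \<open>At most one tree of a disjoint packing uses \<open>e\<close>; the others survive its
  removal.\<close>

lemma tree_packing_number_remove_edge:
  assumes G: "simple_graph V E"
  shows "tree_packing_number V E S \<le> Suc (tree_packing_number V (E - {e}) S)"
proof -
  obtain \<T> where T: "\<T> \<subseteq> S_trees V E S" "pairwise (\<lambda>T U. snd T \<inter> snd U = {}) \<T>"
    "finite \<T>" "card \<T> = tree_packing_number V E S"
    by (rule tree_packing_number_attained[OF G])
  let ?D = "{T \<in> \<T>. e \<in> snd T}"
  have "T = U" if "T \<in> ?D" "U \<in> ?D" for T U
    using T(2) that unfolding pairwise_def by blast
  then have "card ?D \<le> Suc 0" using T(3) by (subst card_le_Suc0_iff_eq) auto
  moreover have "card (\<T> - ?D) \<le> tree_packing_number V (E - {e}) S"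
  proof (rule card_le_tree_packing_number)
    show "simple_graph V (E - {e})" using G by (auto simp: simple_graph_def)
    show "\<T> - ?D \<subseteq> S_trees V (E - {e}) S" using T(1) by (fastforce simp: S_trees_def)
    show "pairwise (\<lambda>T U. snd T \<inter> snd U = {}) (\<T> - ?D)"
      using T(2) by (rule pairwise_subset) auto
  qed
  moreover have "card \<T> = card ?D + card (\<T> - ?D)"
    using T(3) by (subst card_Un_disjoint[symmetric]) (auto intro: arg_cong[of _ _ card])
  ultimately show ?thesis using T(4) by simp
qed

section \<open>Bounds on the generalized edge-connectivity\<close>

lemma gen_edge_connectivity_le:
  assumes "simple_graph V E" "S \<subseteq> V" "card S = k"
  shows "gen_edge_connectivity k V E \<le> tree_packing_number V E S"
proof -
  have "finite {tree_packing_number V E S |S. S \<subseteq> V \<and> card S = k}"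
    using assms by (auto simp: simple_graph_def)
  then show ?thesis using assms by (auto simp: gen_edge_connectivity_def intro!: Min_le)
qed

text \<open>The value is 0 by definition on disconnected graphs, so for \<open>l > 0\<close>
  connectedness has to be derived: two vertices on different sides of a cut fit into one
  \<open>S\<close> of size \<open>k\<close>, and a tree on that \<open>S\<close> crosses the
  cut.\<close>

lemma gen_edge_connectivity_ge:
  assumes G: "simple_graph V E" and k: "2 \<le> k" "k \<le> card V"
    and ge: "\<And>S. S \<subseteq> V \<Longrightarrow> card S = k \<Longrightarrow> l \<le> tree_packing_number V E S"
  shows "l \<le> gen_edge_connectivity k V E"
proof (cases "l = 0")
  case False
  have V: "finite V" and E: "E \<subseteq> all_pairs V" using G by (auto simp: simple_graph_iff)
  have "edge_connects E V"
    unfolding edge_connects_def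
  proof (intro allI impI)
    fix X assume X: "edge_closed E X"
    show "V \<subseteq> X \<or> V \<inter> X = {}"
    proof (rule ccontr)
      assume "\<not> (V \<subseteq> X \<or> V \<inter> X = {})"
      then obtain u v where uv: "u \<in> V" "u \<notin> X" "v \<in> V" "v \<in> X" by blast
      have "card {v, u} \<le> k" using k by (metis card_2_iff uv(2,4))
      then obtain S where S: "{v, u} \<subseteq> S" "S \<subseteq> V" "card S = k"
        using exists_subset_between[of "{v, u}" k V] uv k V by auto
      obtain \<T> where T: "\<T> \<subseteq> S_trees V E S" "pairwise (\<lambda>T U. snd T \<inter> snd U = {}) \<T>"
        "finite \<T>" "card \<T> = tree_packing_number V E S"
        by (rule tree_packing_number_attained[OF G])
      have "\<T> \<noteq> {}" using T(4) ge[OF S(2,3)] False by auto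
      then obtain T where "T \<in> S_trees V E S" using T by blast
      then have "edge_connects E S" using S_treesD edge_connects_mono by metis
      from edge_connectsD[OF this X, of v u] S uv show False by auto
    qed
  qed
  moreover have "V \<noteq> {}" using k by auto
  ultimately have conn: "graph_connected V E" using graph_connected_iff[OF E] by simp
  obtain S where "S \<subseteq> V" "card S = k" using k by (meson obtain_subset_with_card_n)
  then have "Min {tree_packing_number V E S |S. S \<subseteq> V \<and> card S = k} \<ge> l"
    using V ge by (subst Min_ge_iff) auto
  then show ?thesis using conn by (simp add: gen_edge_connectivity_def)
qed simp

text \<open>The loss of at most one tree for each \<open>S\<close> passes to the minimum. A deletion
  that disconnects the graph is covered too, since \<open>gen_edge_connectivity_ge\<close> derives
  connectedness from a positive bound.\<close>

lemma gen_edge_connectivity_remove_edge: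
  assumes "simple_graph V E" "2 \<le> k" "k \<le> card V"
  shows "gen_edge_connectivity k V E \<le> Suc (gen_edge_connectivity k V (E - {e}))"
proof -
  have "gen_edge_connectivity k V E - 1 \<le> gen_edge_connectivity k V (E - {e})"
  proof (rule gen_edge_connectivity_ge[OF _ assms(2,3)])
    show "simple_graph V (E - {e})" using assms(1) by (auto simp: simple_graph_def)
    fix S assume "S \<subseteq> V" "card S = k"
    then show "gen_edge_connectivity k V E - 1 \<le> tree_packing_number V (E - {e}) S"
      using gen_edge_connectivity_le[OF assms(1), of S k]
        tree_packing_number_remove_edge[OF assms(1), of S e] by linarith
  qed
  then show ?thesis by simp
qed

section \<open>Degrees and lower bounds\<close>

text \<open>Every tree has an edge at \<open>v\<close>, and disjointness makes the choice of such an
  edge injective. In the case of equality the choice is a bijection onto the edges at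
  \<open>v\<close>, which leaves each tree exactly one of them.\<close>

lemma card_S_trees_le_degree:
  assumes E: "finite E" and T: "\<T> \<subseteq> S_trees V E S" "pairwise (\<lambda>T U. snd T \<inter> snd U = {}) \<T>"
    and v: "v \<in> S" "w \<in> S" "v \<noteq> w"
  shows "card \<T> \<le> degree E v"
    and "card \<T> = degree E v \<Longrightarrow> e \<in> E \<Longrightarrow> v \<in> e \<Longrightarrow>
      \<exists>T\<in>\<T>. {f \<in> snd T. v \<in> f} = {e}"
proof -
  have "\<exists>e. e \<in> snd T \<and> v \<in> e" if "T \<in> \<T>" for T
    using edge_connects_edge_at[OF S_treesD(2) v] T that by blast
  then obtain f where f: "\<And>T. T \<in> \<T> \<Longrightarrow> f T \<in> snd T \<and> v \<in> f T" by metis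
  have inj: "inj_on f \<T>"
  proof (rule inj_onI)
    fix T U assume TU: "T \<in> \<T>" "U \<in> \<T>" "f T = f U"
    then have "snd T \<inter> snd U \<noteq> {}" using f by (metis disjoint_iff)
    then show "T = U" using T(2) TU by (auto simp: pairwise_def)
  qed
  have sub: "f ` \<T> \<subseteq> {e \<in> E. v \<in> e}" using f T(1) S_treesD(1) by blast
  then show "card \<T> \<le> degree E v"
    unfolding degree_def using E inj by (intro card_inj_on_le[of f]) auto
  assume eq: "card \<T> = degree E v" and e: "e \<in> E" "v \<in> e"
  have img: "f ` \<T> = {e \<in> E. v \<in> e}"
    using sub E eq card_image[OF inj] by (intro card_subset_eq) (auto simp: degree_def)
  then obtain T0 where T0: "T0 \<in> \<T>" "f T0 = e" using e by (metis (mono_tags) imageE mem_Collect_eq)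
  \<comment> \<open>A second edge \<open>g\<close> of \<open>T0\<close> at \<open>v\<close> is the
    chosen edge of some tree \<open>U\<close>; sharing \<open>g\<close> forces
    \<open>U = T0\<close>, hence \<open>g = e\<close>.\<close>
  have "g = e" if g: "g \<in> snd T0" "v \<in> g" for g
  proof -
    have "g \<in> E" using g T0 T(1) S_treesD(1) by blast
    then obtain U where U: "U \<in> \<T>" "f U = g"
      using img g(2) by (metis (mono_tags, lifting) imageE mem_Collect_eq)
    then have "snd T0 \<inter> snd U \<noteq> {}" using f g by blast
    then have "T0 = U" using T(2) T0 U by (auto simp: pairwise_def)
    then show ?thesis using T0 U by simp
  qed
  then show "\<exists>T\<in>\<T>. {f \<in> snd T. v \<in> f} = {e}" using T0 f by blast
qed

lemma gen_edge_connectivity_le_degree: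
  assumes G: "simple_graph V E" and n: "3 \<le> card V" and v: "v \<in> V"
  shows "gen_edge_connectivity 3 V E \<le> degree E v"
proof -
  have V: "finite V" using G by (simp add: simple_graph_def)
  obtain S where S: "{v} \<subseteq> S" "S \<subseteq> V" "card S = 3"
    using exists_subset_between[of "{v}" 3 V] v n V by auto
  then obtain w where w: "w \<in> S" "v \<noteq> w" by (auto simp: card_3_iff)
  obtain \<T> where "\<T> \<subseteq> S_trees V E S" "pairwise (\<lambda>T U. snd T \<inter> snd U = {}) \<T>"
    "finite \<T>" "card \<T> = tree_packing_number V E S"
    by (rule tree_packing_number_attained[OF G])
  from card_S_trees_le_degree(1)[OF simple_graph_finite_edges[OF G] this(1,2), of v w] this(4) S w
  have "tree_packing_number V E S \<le> degree E v" by auto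
  then show ?thesis using gen_edge_connectivity_le[OF G S(2,3)] by simp
qed

text \<open>
  If both ends of an edge \<open>uv\<close> had minimum degree \<open>l\<close>, then \<open>l\<close> disjoint trees would meet each of
  \<open>u\<close>, \<open>v\<close> in exactly one edge, and the tree through \<open>uv\<close> could not reach a third vertex.
\<close>

lemma tight_degrees_not_adjacent:
  assumes G: "simple_graph V E" and n: "3 \<le> card V" and uv: "{u, v} \<in> E"
    and u: "degree E u = gen_edge_connectivity 3 V E"
    and v: "degree E v = gen_edge_connectivity 3 V E"
  shows False
proof -
  have V: "finite V" using G by (simp add: simple_graph_def)
  have uvV: "u \<in> V" "v \<in> V" "u \<noteq> v" using G uv pair_in_all_pairs_iff[of u v V] unfolding simple_graph_iff by blast+
  obtain S where S: "{u, v} \<subseteq> S" "S \<subseteq> V" "card S = 3"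
    using exists_subset_between[of "{u, v}" 3 V] uvV n V by auto
  obtain w where w: "w \<in> S" "w \<noteq> u" "w \<noteq> v"
    using S by (auto simp: card_3_iff doubleton_eq_iff)
  obtain \<T> where T: "\<T> \<subseteq> S_trees V E S" "pairwise (\<lambda>T U. snd T \<inter> snd U = {}) \<T>"
    "finite \<T>" "card \<T> = tree_packing_number V E S"
    by (rule tree_packing_number_attained[OF G])
  note deg = card_S_trees_le_degree[OF simple_graph_finite_edges[OF G] T(1,2)]
  have ge: "gen_edge_connectivity 3 V E \<le> card \<T>"
    using gen_edge_connectivity_le[OF G S(2,3)] T(4) by simp
  have "card \<T> = degree E u" "card \<T> = degree E v"
    using deg(1)[of u v] deg(1)[of v u] ge u v S uvV by auto
  \<comment> \<open>Both ends are tight, so the tree through the edge \<open>{u, v}\<close> has no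
    other edge at \<open>u\<close> and none at \<open>v\<close>; \<open>T\<close> and
    \<open>U\<close> coincide because they share that edge.\<close>
  then obtain T U where TU: "T \<in> \<T>" "{f \<in> snd T. u \<in> f} = {{u, v}}"
    "U \<in> \<T>" "{f \<in> snd U. v \<in> f} = {{u, v}}"
    using deg(2)[of u v "{u, v}"] deg(2)[of v u "{u, v}"] S uvV uv by auto
  have "{u, v} \<in> snd T" "{u, v} \<in> snd U" using TU by blast+
  then have "U = T" using T(2) TU by (auto simp: pairwise_def)
  have "edge_closed (snd T) {u, v}"
    unfolding edge_closed_def
  proof
    fix f assume f: "f \<in> snd T"
    have "f = {u, v}" if "u \<in> f" using f that TU(2) by blast
    moreover have "f = {u, v}" if "v \<in> f" using f that TU(4) \<open>U = T\<close> by blast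
    ultimately show "f \<subseteq> {u, v} \<or> f \<inter> {u, v} = {}" by blast
  qed
  moreover have "edge_connects (snd T) S" using subsetD[OF T(1) TU(1)] by (rule S_treesD(2))
  ultimately show False using edge_connectsD[of "snd T" S "{u, v}" u w] S w by auto
qed

text \<open>A discrete intermediate value argument: edges are deleted one at a time, each deletion
  lowers the value by at most one, and a value above \<open>l\<close> guarantees that an edge is
  left to delete.\<close>

lemma ex_subgraph_with_gen_edge_connectivity:
  assumes "simple_graph V E" "3 \<le> card V" "l \<le> gen_edge_connectivity 3 V E"
  shows "\<exists>E'. simple_graph V E' \<and> gen_edge_connectivity 3 V E' = l"
  using assms
proof (induction "card E" arbitrary: E rule: less_induct)
  case less
  show ?case
  proof (cases "gen_edge_connectivity 3 V E = l")
    case False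
    with less have gt: "l < gen_edge_connectivity 3 V E" by simp
    obtain v where v: "v \<in> V" using less.prems(2) by fastforce
    have "0 < degree E v"
      using gen_edge_connectivity_le_degree[OF less.prems(1,2) v] gt by simp
    then obtain e where e: "e \<in> E" by (auto simp: degree_def card_gt_0_iff)
    have "card (E - {e}) < card E"
      using e simple_graph_finite_edges[OF less.prems(1)] by (intro card_Diff1_less) auto
    moreover have "simple_graph V (E - {e})" using less.prems(1) by (auto simp: simple_graph_def)
    moreover have "l \<le> gen_edge_connectivity 3 V (E - {e})"
      using gen_edge_connectivity_remove_edge[OF less.prems(1) _ less.prems(2), of e] gt by simp
    ultimately show ?thesis using less.hyps less.prems(2) by blast
  qed (use less.prems in blast)
qed

section \<open>Handshake lemma, complements and edge counts\<close>

lemma sum_degree: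
  assumes "finite V" "E \<subseteq> all_pairs V"
  shows "(\<Sum>v\<in>V. degree E v) = 2 * card E"
proof -
  have "(\<Sum>v\<in>V. card {e \<in> E. v \<in> e}) = 2 * card E"
  proof (rule sum_multicount)
    show "finite V" "finite E" using assms finite_all_pairs finite_subset by blast+
    show "\<forall>e\<in>E. card {v \<in> V. v \<in> e} = 2"
    proof
      fix e assume "e \<in> E"
      then have "e \<subseteq> V" "card e = 2" using assms by (auto simp: all_pairs_def)
      moreover from this have "{v \<in> V. v \<in> e} = e" by blast
      ultimately show "card {v \<in> V. v \<in> e} = 2" by simp
    qed
  qed
  then show ?thesis by (simp add: degree_def)
qed

lemma degree_complement:
  assumes V: "finite V" "E \<subseteq> all_pairs V" "v \<in> V"
  shows "degree E v + degree (all_pairs V - E) v = card V - 1"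
proof -
  have "{e \<in> all_pairs V. v \<in> e} = (\<lambda>u. {v, u}) ` (V - {v})"
    by (auto simp: pair_in_all_pairs_iff V(3) elim!: all_pairsE)
  moreover have "inj_on (\<lambda>u. {v, u}) (V - {v})"
    by (auto simp: inj_on_def doubleton_eq_iff)
  ultimately have "card {e \<in> all_pairs V. v \<in> e} = card V - 1"
    using V by (simp add: card_image)
  moreover have "{e \<in> all_pairs V. v \<in> e} = {e \<in> E. v \<in> e} \<union> {e \<in> all_pairs V - E. v \<in> e}"
    using V by blast
  moreover have "finite (all_pairs V)" "finite E"
    using V finite_all_pairs finite_subset by blast+
  ultimately show ?thesis
    unfolding degree_def by (subst card_Un_disjoint[symmetric]) auto
qed

lemma degree_pos:
  assumes "finite E" "{u, v} \<in> E"
  shows "1 \<le> degree E u"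
proof -
  have "0 < card {e \<in> E. u \<in> e}" using assms by (subst card_gt_0_iff) auto
  then show ?thesis by (simp add: degree_def)
qed

lemma card_complement:
  assumes "simple_graph V E"
  shows "card E + card (all_pairs V - E) = card V choose 2"
proof -
  have "card (E \<union> (all_pairs V - E)) = card E + card (all_pairs V - E)"
    using assms simple_graph_finite_edges[OF assms]
    by (intro card_Un_disjoint) (auto simp: simple_graph_iff finite_all_pairs)
  moreover have "E \<union> (all_pairs V - E) = all_pairs V" using assms by (auto simp: simple_graph_iff)
  ultimately show ?thesis using assms by (simp add: card_all_pairs simple_graph_iff)
qed

text \<open>The degree bound leaves complement degrees of at most one, so the ends of a non-edge
  have tight degree. Given two non-edges, an end \<open>p\<close> of one and an end \<open>r\<close>
  of the other are tight, hence non-adjacent, which gives \<open>p\<close> a second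
  non-edge.\<close>

lemma card_complement_le_1:
  assumes G: "simple_graph V E" and n: "3 \<le> card V"
    and l: "gen_edge_connectivity 3 V E = card V - 2"
  shows "card (all_pairs V - E) \<le> 1"
proof -
  let ?N = "all_pairs V - E"
  have V: "finite V" and E: "E \<subseteq> all_pairs V" using G by (auto simp: simple_graph_iff)
  have N: "finite ?N" using V by (simp add: finite_all_pairs)
  have codeg: "degree ?N v \<le> 1" if "v \<in> V" for v
    using gen_edge_connectivity_le_degree[OF G n that] degree_complement[OF V E that] l n by linarith
  have tight: "degree E v = card V - 2" if "{v, u} \<in> ?N" for u v
  proof -
    have "v \<in> V" using that by (auto simp: pair_in_all_pairs_iff)
    then show ?thesis
      using codeg[of v] degree_complement[OF V E, of v] degree_pos[OF N that] by linarith
  qed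
  have "e = f" if ef: "e \<in> ?N" "f \<in> ?N" for e f
  proof (rule ccontr)
    assume "e \<noteq> f"
    moreover have "card e = card f" "finite e" "finite f"
      using ef by (auto simp: all_pairs_def card_2_iff)
    \<comment> \<open>Distinct sets of equal size: \<open>f\<close> has a vertex off
      \<open>e\<close>, which keeps \<open>{p, r}\<close> different from
      \<open>{p, q}\<close>.\<close>
    ultimately have "\<not> f \<subseteq> e" using card_subset_eq by metis
    then obtain r where r: "r \<in> f" "r \<notin> e" by blast
    obtain p q where pq: "e = {p, q}" using ef(1) by (auto elim: all_pairsE)
    obtain s where s: "f = {r, s}" using ef(2) r(1) by (auto elim!: all_pairsE)
    have pr: "p \<in> V" "r \<in> V" "p \<noteq> r" using ef pq s r by (auto simp: pair_in_all_pairs_iff)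
    have "{p, r} \<notin> E"
      using tight_degrees_not_adjacent[OF G n, of p r] tight[of p q] tight[of r s] ef pq s l by auto
    then have "{{p, q}, {p, r}} \<subseteq> {e \<in> ?N. p \<in> e}"
      using ef pq pr by (auto simp: pair_in_all_pairs_iff)
    then have "card {{p, q}, {p, r}} \<le> degree ?N p"
      unfolding degree_def by (intro card_mono finite_subset[OF _ N]) auto
    moreover have "card {{p, q}, {p, r}} = 2" using r pq by (subst card_2_iff) (auto simp: doubleton_eq_iff)
    ultimately show False using codeg[OF pr(1)] by simp
  qed
  then show ?thesis using N by (simp add: card_le_Suc0_iff_eq)
qed

text \<open>Complement degrees are at most two, and the vertices in \<open>D\<close> that reach two
  are tight, hence pairwise adjacent in the complement. Thus \<open>D\<close> has at most three
  vertices, and the complement degrees sum to at most \<open>card V + 3\<close>.\<close>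

lemma card_complement_le:
  assumes G: "simple_graph V E" and n: "3 \<le> card V"
    and l: "gen_edge_connectivity 3 V E = card V - 3"
  shows "2 * card (all_pairs V - E) \<le> card V + 3"
proof -
  let ?N = "all_pairs V - E"
  have V: "finite V" and E: "E \<subseteq> all_pairs V" using G by (auto simp: simple_graph_iff)
  have N: "finite ?N" using V by (simp add: finite_all_pairs)
  have codeg: "degree ?N v \<le> 2" if "v \<in> V" for v
    using gen_edge_connectivity_le_degree[OF G n that] degree_complement[OF V E that] l n by linarith
  define D where "D = {v \<in> V. degree ?N v = 2}"
  have D: "finite D" "D \<subseteq> V" using V by (auto simp: D_def)
  have tight: "degree E v = card V - 3" if "v \<in> D" for v
    using degree_complement[OF V E, of v] that by (simp add: D_def)
  have "card D \<le> 3"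
  proof (cases "D = {}")
    case False
    then obtain v where v: "v \<in> D" by blast
    have "(\<lambda>u. {v, u}) ` (D - {v}) \<subseteq> {e \<in> ?N. v \<in> e}"
    proof clarify
      fix u assume u: "u \<in> D" "u \<noteq> v"
      have "{v, u} \<notin> E"
        using tight_degrees_not_adjacent[OF G n, of v u] tight[of v] tight[of u] u v l by auto
      then show "{v, u} \<in> ?N \<and> v \<in> {v, u}" using u v D by (auto simp: pair_in_all_pairs_iff)
    qed
    moreover have "inj_on (\<lambda>u. {v, u}) (D - {v})" by (auto simp: inj_on_def doubleton_eq_iff)
    ultimately have "card (D - {v}) \<le> degree ?N v"
      unfolding degree_def by (intro card_inj_on_le finite_subset[OF _ N]) auto
    then show ?thesis using v D by (simp add: D_def)
  qed simp
  have "2 * card ?N = (\<Sum>v\<in>V. degree ?N v)" using sum_degree[of V ?N] V by auto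
  also have "\<dots> \<le> (\<Sum>v\<in>V. 1 + (if v \<in> D then 1 else 0))"
  proof (rule sum_mono)
    fix v assume "v \<in> V"
    then show "degree ?N v \<le> 1 + (if v \<in> D then 1 else 0)" using codeg[of v] by (auto simp: D_def)
  qed
  also have "\<dots> = card V + card (V \<inter> D)"
    using V by (subst sum.distrib) (simp add: sum.If_cases)
  also have "V \<inter> D = D" using D by blast
  finally show ?thesis using \<open>card D \<le> 3\<close> by simp
qed

text \<open>The tight vertices \<open>X\<close> are independent, so the edges at them are counted
  once and \<open>l * card X \<le> card E\<close>. All other degrees are at least
  \<open>l + 1\<close>, so \<open>(l + 1) * card V \<le> 2 * card E + card X\<close>. Adding
  \<open>l\<close> times the second bound to the first eliminates \<open>card X\<close>.\<close>

lemma card_edges_ge: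
  assumes G: "simple_graph V E" and n: "3 \<le> card V"
    and l: "gen_edge_connectivity 3 V E = l"
  shows "l * (l + 1) * card V \<le> (2 * l + 1) * card E"
proof -
  have V: "finite V" and E: "E \<subseteq> all_pairs V" using G by (auto simp: simple_graph_iff)
  have finE: "finite E" using G by (rule simple_graph_finite_edges)
  define X where "X = {v \<in> V. degree E v = l}"
  have X: "finite X" "X \<subseteq> V" using V by (auto simp: X_def)
  have "card (\<Union>v\<in>X. {e \<in> E. v \<in> e}) = (\<Sum>v\<in>X. card {e \<in> E. v \<in> e})"
  proof (rule card_UN_disjoint)
    show "\<forall>u\<in>X. \<forall>v\<in>X. u \<noteq> v \<longrightarrow> {e \<in> E. u \<in> e} \<inter> {e \<in> E. v \<in> e} = {}"
    proof (intro ballI impI)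
      fix u v assume uv: "u \<in> X" "v \<in> X" "u \<noteq> v"
      have "e = {u, v}" if "e \<in> E" "u \<in> e" "v \<in> e" for e
        using that uv(3) E by (auto elim!: all_pairsE dest!: subsetD)
      moreover have "{u, v} \<notin> E"
        using tight_degrees_not_adjacent[OF G n, of u v] uv l by (auto simp: X_def)
      ultimately show "{e \<in> E. u \<in> e} \<inter> {e \<in> E. v \<in> e} = {}" by blast
    qed
  qed (use X finE in auto)
  also have "\<dots> = l * card X" by (simp add: X_def degree_def[symmetric])
  finally have "l * card X = card (\<Union>v\<in>X. {e \<in> E. v \<in> e})" ..
  also have "\<dots> \<le> card E" using finE by (intro card_mono) auto
  finally have lX: "l * card X \<le> card E" .
  have "(l + 1) * card V = (\<Sum>v\<in>V. l + 1)" by simp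
  also have "\<dots> \<le> (\<Sum>v\<in>V. degree E v + (if v \<in> X then 1 else 0))"
  proof (rule sum_mono)
    fix v assume "v \<in> V"
    then show "l + 1 \<le> degree E v + (if v \<in> X then 1 else 0)"
      using gen_edge_connectivity_le_degree[OF G n, of v] l by (auto simp: X_def)
  qed
  also have "\<dots> = 2 * card E + card (V \<inter> X)"
    using V sum_degree[OF V E] by (subst sum.distrib) (simp add: sum.If_cases)
  also have "V \<inter> X = X" using X by blast
  finally have "l * ((l + 1) * card V) \<le> l * (2 * card E + card X)" by (rule mult_le_mono2)
  also have "\<dots> = 2 * l * card E + l * card X" by (simp add: algebra_simps)
  also have "\<dots> \<le> (2 * l + 1) * card E" using lX by simp
  finally show ?thesis by (simp only: mult.assoc)
qed

text \<open>\<open>R\<close> grows by one vertex along an edge that leaves it. That edge is counted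
  for \<open>R\<close> but no longer for the larger set, so every new vertex pays with an edge of
  its own.\<close>

lemma card_le_card_edges_outside:
  assumes V: "finite V" and E: "E \<subseteq> all_pairs V" and conn: "edge_connects E V"
    and "R \<subseteq> V" "R \<noteq> {}"
  shows "card (V - R) \<le> card {e \<in> E. \<not> e \<subseteq> R}"
  using assms(4,5)
proof (induction "card (V - R)" arbitrary: R)
  case (Suc k)
  have finE: "finite E" using V E finite_all_pairs finite_subset by blast
  have "\<not> edge_closed E R"
  proof
    assume "edge_closed E R"
    then have "V \<subseteq> R \<or> V \<inter> R = {}" using conn by (simp add: edge_connects_def)
    then have "V - R = {}" using Suc.prems by blast
    then show False using Suc.hyps(2) by (metis card.empty nat.distinct(1))
  qed
  then obtain e where e: "e \<in> E" "e \<inter> R \<noteq> {}" "\<not> e \<subseteq> R" unfolding edge_closed_def by blast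
  moreover obtain x y where "e = {x, y}" "x \<in> V" "y \<in> V" using e(1) E by (meson all_pairsE subsetD)
  ultimately obtain v where v: "v \<in> V" "v \<notin> R" "e \<subseteq> insert v R" by auto
  have "V - insert v R = (V - R) - {v}" by blast
  then have k: "k = card (V - insert v R)" using Suc.hyps(2) v V by simp
  have "card (V - insert v R) \<le> card {f \<in> E. \<not> f \<subseteq> insert v R}"
    using v Suc.prems by (intro Suc.hyps(1)[OF k]) auto
  moreover have "{f \<in> E. \<not> f \<subseteq> insert v R} \<subset> {f \<in> E. \<not> f \<subseteq> R}" using e v by blast
  then have "card {f \<in> E. \<not> f \<subseteq> insert v R} < card {f \<in> E. \<not> f \<subseteq> R}"
    using finE by (intro psubset_card_mono) auto
  ultimately show ?case using k Suc.hyps(2) by simp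
qed simp

lemma graph_connected_card_le:
  assumes "simple_graph V E" "graph_connected V E"
  shows "card V \<le> Suc (card E)"
proof -
  have V: "finite V" "E \<subseteq> all_pairs V" using assms by (auto simp: simple_graph_iff)
  obtain v where v: "v \<in> V" and conn: "edge_connects E V"
    using assms(2) graph_connected_iff[OF V(2)] by blast
  have "card (V - {v}) \<le> card {e \<in> E. \<not> e \<subseteq> {v}}"
    using card_le_card_edges_outside[OF V conn, of "{v}"] v by blast
  also have "\<dots> \<le> card E" using simple_graph_finite_edges[OF assms(1)] by (intro card_mono) auto
  finally show ?thesis using v V by simp
qed

section \<open>Complete multipartite graphs\<close>

text \<open>The classes are the fibres of a labelling \<open>g\<close>, so adjacency of concrete
  vertices reduces to comparing labels.\<close>

definition multipartite :: "'a set \<Rightarrow> ('a \<Rightarrow> 'b) \<Rightarrow> 'a set set" where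
  "multipartite V g = {{u, v} |u v. u \<in> V \<and> v \<in> V \<and> g u \<noteq> g v}"

lemma pair_in_multipartite_iff:
  "{u, v} \<in> multipartite V g \<longleftrightarrow> u \<in> V \<and> v \<in> V \<and> g u \<noteq> g v"
  unfolding multipartite_def by (auto simp: doubleton_eq_iff)

lemma simple_graph_multipartite: "finite V \<Longrightarrow> simple_graph V (multipartite V g)"
  by (auto simp: simple_graph_def multipartite_def card_2_iff)

lemma degree_multipartite_le:
  assumes "finite V"
  shows "degree (multipartite V g) v \<le> card {u \<in> V. g u \<noteq> g v}"
proof -
  have "{e \<in> multipartite V g. v \<in> e} \<subseteq> (\<lambda>u. {v, u}) ` {u \<in> V. g u \<noteq> g v}"
    by (auto simp: multipartite_def)
  then show ?thesis unfolding degree_def using assms by (intro surj_card_le) auto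
qed

text \<open>Each vertex outside \<open>S\<close> and \<open>B\<close> is adjacent to all of
  \<open>S\<close> and centres a star on it. These stars are disjoint from each other and from the
  trees \<open>Fs\<close>, which stay within \<open>S \<union> B\<close>. \<open>B\<close> holds the
  class mates of \<open>S\<close>, together with any vertices that the trees \<open>Fs\<close> pass
  through. The additive form avoids truncated subtraction.\<close>

lemma tree_packing_number_multipartite:
  assumes V: "finite V" and S: "S \<subseteq> V" "card S = 3" and B: "B \<subseteq> V - S"
    and foreign: "\<And>v s. v \<in> V - S - B \<Longrightarrow> s \<in> S \<Longrightarrow> g v \<noteq> g s"
    and disj: "sorted_wrt (\<lambda>A B. A \<inter> B = {}) Fs"
    and Fs: "\<And>F. F \<in> set Fs \<Longrightarrow> F \<subseteq> multipartite (S \<union> B) g \<and> edge_connects F S"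
  shows "card V + length Fs \<le> tree_packing_number V (multipartite V g) S + card B + 3"
proof -
  let ?star = "\<lambda>v. (\<lambda>s. {v, s}) ` S"
  obtain vs where vs: "set vs = V - S - B" "distinct vs"
    using finite_distinct_list[of "V - S - B"] V by auto
  have len: "length vs + card B + 3 = card V"
  proof -
    have fin: "finite S" "finite B" using V S B finite_subset by blast+
    have "length vs = card (V - (S \<union> B))"
      using distinct_card[OF vs(2)] vs(1) by (simp add: set_diff_eq)
    also have "\<dots> = card V - card (S \<union> B)" using V S B fin by (intro card_Diff_subset) auto
    also have "card (S \<union> B) = card B + 3" using fin B S by (subst card_Un_disjoint) auto
    finally have "length vs = card V - (card B + 3)" .
    moreover have "card (S \<union> B) \<le> card V" using V S B by (intro card_mono) auto
    ultimately show ?thesis using \<open>card (S \<union> B) = card B + 3\<close> by simp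
  qed
  have "length (Fs @ map ?star vs) \<le> tree_packing_number V (multipartite V g) S"
  proof (rule length_le_tree_packing_number)
    show "simple_graph V (multipartite V g)" using V by (rule simple_graph_multipartite)
    have "sorted_wrt (\<lambda>v w. ?star v \<inter> ?star w = {}) vs"
      unfolding sorted_wrt_iff_nth_less
    proof (intro allI impI)
      fix i j assume ij: "i < j" "j < length vs"
      then have "vs ! i \<noteq> vs ! j" using vs(2) by (simp add: nth_eq_iff_index_eq)
      moreover have "vs ! i \<notin> S" "vs ! j \<notin> S" using ij vs(1) nth_mem[of _ vs] by auto
      \<comment> \<open>Both centres lie outside \<open>S\<close>, so an edge determines the centre
        of its star.\<close>
      ultimately show "?star (vs ! i) \<inter> ?star (vs ! j) = {}" by (auto simp: doubleton_eq_iff)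
    qed
    moreover have "F \<inter> ?star v = {}" if "F \<in> set Fs" "v \<in> set vs" for F v
    proof -
      have "e \<subseteq> S \<union> B" if "e \<in> F" for e
        using Fs[OF \<open>F \<in> set Fs\<close>] that by (auto simp: multipartite_def)
      moreover have "v \<notin> S \<union> B" using that vs by auto
      ultimately show ?thesis by blast
    qed
    ultimately show "sorted_wrt (\<lambda>A B. A \<inter> B = {}) (Fs @ map ?star vs)"
      using disj by (auto simp: sorted_wrt_append sorted_wrt_map)
    fix F assume "F \<in> set (Fs @ map ?star vs)"
    then consider "F \<in> set Fs" | v where "v \<in> V - S - B" "F = ?star v" using vs by auto
    then show "F \<subseteq> multipartite V g \<and> edge_connects F S"
    proof cases
      case 1
      then show ?thesis using Fs[OF 1] S B by (auto simp: multipartite_def) blast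
    next
      case 2
      have "edge_connects F S"
        unfolding edge_connects_def edge_closed_def 2 by auto
      then show ?thesis using foreign 2 S by (auto simp: pair_in_multipartite_iff)
    qed
  qed (use S in auto)
  then show ?thesis using len by simp
qed

lemma edge_closed_insert_pair:
  "edge_closed (insert {u, v} F) X \<longleftrightarrow> (u \<in> X \<longleftrightarrow> v \<in> X) \<and> edge_closed F X"
  by (auto simp: edge_closed_def)

lemma edge_closed_empty: "edge_closed {} X"
  by (simp add: edge_closed_def)

lemma edge_connects_triple_iff:
  "edge_connects F {x, y, z} \<longleftrightarrow>
     (\<forall>X. edge_closed F X \<longrightarrow> (x \<in> X \<longleftrightarrow> y \<in> X) \<and> (y \<in> X \<longleftrightarrow> z \<in> X))"
  unfolding edge_connects_def by blast

text \<open>For explicit edge sets these rules turn adjacency, disjointness and connection into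
  label comparisons, vertex equalities and propositional facts about an arbitrary cut.\<close>

lemmas explicit_packing_simps =
  pair_in_multipartite_iff edge_closed_insert_pair edge_closed_empty edge_connects_triple_iff
  doubleton_eq_iff

text \<open>The classes of the graphs treated below are intervals, so with \<open>S\<close> in
  increasing order the case analysis becomes a comparison with the class boundaries.\<close>

lemma card_3_ordered:
  fixes S :: "nat set"
  assumes "card S = 3"
  obtains x y z where "S = {x, y, z}" "x < y" "y < z"
proof -
  obtain a b c where S: "S = {a, b, c}" and d: "a \<noteq> b" "a \<noteq> c" "b \<noteq> c"
    using assms by (auto simp: card_3_iff)
  show thesis
    using that[of a b c] that[of a c b] that[of b a c] that[of b c a] that[of c a b] that[of c b a]
      S d by (auto simp: insert_commute neq_iff)
qed

lemma min_size_eqI: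
  fixes V :: "nat set"
  assumes "simple_graph V E" "card V = n" "gen_edge_connectivity k V E = l" "card E = m"
    and "\<And>(V :: nat set) E. simple_graph V E \<Longrightarrow> card V = n \<Longrightarrow>
      gen_edge_connectivity k V E = l \<Longrightarrow> m \<le> card E"
  shows "min_size n k l = m"
  unfolding min_size_def using assms by (intro Least_equality) blast+

text \<open>\<open>LEAST\<close> says nothing about an empty set, so a witness graph has to be
  supplied.\<close>

lemma min_size_attained:
  fixes V :: "nat set"
  assumes "simple_graph V E" "card V = n" "gen_edge_connectivity k V E = l"
  obtains V' :: "nat set" and E' where "simple_graph V' E'" "card V' = n"
    "gen_edge_connectivity k V' E' = l" "card E' = min_size n k l"
proof -
  have "\<exists>m. \<exists>(V :: nat set) E. simple_graph V E \<and> card V = n \<and>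
    gen_edge_connectivity k V E = l \<and> card E = m"
    using assms by blast
  from LeastI_ex[OF this] show thesis
    unfolding min_size_def[symmetric] using that by blast
qed

section \<open>The extremal graphs\<close>

text \<open>With truncated subtraction, the only nontrivial class of \<open>v - 1\<close> is \<open>{0, 1}\<close>.\<close>

lemma gen_edge_connectivity_almost_complete:
  fixes n :: nat
  assumes n: "3 \<le> n"
  shows "gen_edge_connectivity 3 {..<n} (multipartite {..<n} (\<lambda>v. v - 1)) = n - 2"
proof (rule antisym)
  define V where "V = {..<n}"
  define g :: "nat \<Rightarrow> nat" where "g = (\<lambda>v. v - 1)"
  have G: "simple_graph V (multipartite V g)" by (simp add: V_def simple_graph_multipartite)
  have "degree (multipartite V g) 0 \<le> card {u \<in> V. g u \<noteq> g 0}"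
    by (rule degree_multipartite_le) (simp add: V_def)
  also have "{u \<in> V. g u \<noteq> g 0} = {2..<n}" by (auto simp: V_def g_def)
  finally show "gen_edge_connectivity 3 {..<n} (multipartite {..<n} (\<lambda>v. v - 1)) \<le> n - 2"
    using gen_edge_connectivity_le_degree[OF G, of 0] n by (simp add: V_def g_def)
  have g_eq: "g u = g v \<longleftrightarrow> u = v \<or> u \<le> 1 \<and> v \<le> 1" for u v by (auto simp: g_def)
  have "n - 2 \<le> gen_edge_connectivity 3 V (multipartite V g)"
  proof (rule gen_edge_connectivity_ge[OF G])
    fix S assume S: "S \<subseteq> V" "card S = 3"
    obtain x y z where xyz: "S = {x, y, z}" "x < y" "y < z" using S(2) by (rule card_3_ordered)
    have V: "x \<in> V" "y \<in> V" "z \<in> V" "finite V" using S xyz by (auto simp: V_def)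
    have dist: "distinct [x, y, z]" using xyz by simp
    \<comment> \<open>The cases count how many of the two non-adjacent vertices 0 and 1 lie in
      \<open>S\<close>. There are \<open>n - 3\<close> vertices outside \<open>S\<close>, so one
      tree more than there are vertices in \<open>B\<close> is required.\<close>
    consider (two) "y \<le> 1" | (one) "x \<le> 1" "1 < y" | (zero) "1 < x" by linarith
    then show "n - 2 \<le> tree_packing_number V (multipartite V g) S"
    proof cases
      case two
      have "card V + length [{{x, z}, {y, z}}]
        \<le> tree_packing_number V (multipartite V g) {x, y, z} + card ({} :: nat set) + 3"
        by (rule tree_packing_number_multipartite)
          (use V dist two xyz(2,3) in \<open>auto simp: explicit_packing_simps g_eq\<close>)
      then show ?thesis using xyz by (simp add: V_def)
    next
      case one
      \<comment> \<open>\<open>q\<close> is the other one of 0 and 1. It is not adjacent to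
        \<open>x\<close> and centres no star, so it goes into \<open>B\<close>; the second tree uses
        it to join \<open>y\<close> to \<open>z\<close>.\<close>
      define q where "q = 1 - x"
      have q: "q \<in> V" "q \<le> 1" "distinct [x, y, z, q]"
        using one xyz n unfolding q_def V_def by auto presburger
      have q_eq: "v \<le> 1 \<longleftrightarrow> v = x \<or> v = q" for v using one by (auto simp: q_def)
      have cls: "\<And>v. g v = g x \<longleftrightarrow> v = x \<or> v = q" "\<And>v. g v = g q \<longleftrightarrow> v = x \<or> v = q"
        "\<And>v. g v = g y \<longleftrightarrow> v = y" "\<And>v. g v = g z \<longleftrightarrow> v = z"
        using q(3) one xyz unfolding g_eq q_eq by auto
      have "card V + length [{{x, y}, {y, z}}, {{x, z}, {q, y}, {q, z}}]
        \<le> tree_packing_number V (multipartite V g) {x, y, z} + card {q} + 3"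
        by (rule tree_packing_number_multipartite)
          (use V q(1,3) in \<open>auto simp: explicit_packing_simps cls\<close>)
      then show ?thesis using xyz by (simp add: V_def)
    next
      case zero
      have "card V + length [{{x, z}, {y, z}}]
        \<le> tree_packing_number V (multipartite V g) {x, y, z} + card ({} :: nat set) + 3"
        by (rule tree_packing_number_multipartite)
          (use V dist zero xyz(2,3) in \<open>auto simp: explicit_packing_simps g_eq\<close>)
      then show ?thesis using xyz by (simp add: V_def)
    qed
  qed (use n in \<open>auto simp: V_def\<close>)
  then show "n - 2 \<le> gen_edge_connectivity 3 {..<n} (multipartite {..<n} (\<lambda>v. v - 1))"
    by (simp add: V_def g_def)
qed

text \<open>With truncated subtraction, the classes of \<open>(v - 1) div 2\<close> are \<open>{0, 1, 2}\<close>, \<open>{3, 4}\<close>, \<open>{5, 6}\<close>, \<open>\<dots>\<close>\<close>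

lemma gen_edge_connectivity_triangle_matching_complement:
  fixes n :: nat
  assumes n: "3 \<le> n"
  shows "gen_edge_connectivity 3 {..<n} (multipartite {..<n} (\<lambda>v. (v - 1) div 2)) = n - 3"
proof (rule antisym)
  define V where "V = {..<n}"
  define g :: "nat \<Rightarrow> nat" where "g = (\<lambda>v. (v - 1) div 2)"
  have G: "simple_graph V (multipartite V g)" by (simp add: V_def simple_graph_multipartite)
  have "degree (multipartite V g) 0 \<le> card {u \<in> V. g u \<noteq> g 0}"
    by (rule degree_multipartite_le) (simp add: V_def)
  also have "{u \<in> V. g u \<noteq> g 0} = {3..<n}" by (auto simp: V_def g_def)
  finally show "gen_edge_connectivity 3 {..<n} (multipartite {..<n} (\<lambda>v. (v - 1) div 2)) \<le> n - 3"
    using gen_edge_connectivity_le_degree[OF G, of 0] n by (simp add: V_def g_def)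
  have triangle: "g v = g x \<longleftrightarrow> v \<le> 2" if "x \<le> 2" for v x using that by (auto simp: g_def)
  \<comment> \<open>The class mate of a vertex above 2. For the largest vertex it may be
    \<open>n\<close>, outside \<open>V\<close>; the bound \<open>Suc u\<close> places it in
    \<open>V\<close> as soon as \<open>V\<close> has a vertex above \<open>u\<close>.\<close>
  have partner: thesis
    if "2 < u" and "\<And>u'. \<lbrakk>u' \<noteq> u; 2 < u'; u' \<le> Suc u; \<And>v. g v = g u \<longleftrightarrow> v = u \<or> v = u';
      \<And>v. g v = g u' \<longleftrightarrow> v = u \<or> v = u'\<rbrakk> \<Longrightarrow> thesis" for u thesis
  proof -
    define m where "m = g u"
    have m: "1 \<le> m" using that(1) unfolding m_def g_def by linarith
    have cls: "g v = m \<longleftrightarrow> v = Suc (2 * m) \<or> v = Suc (Suc (2 * m))" for v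
    proof -
      have "g v = m \<longleftrightarrow> 2 * m \<le> v - 1 \<and> v - 1 < 2 * m + 2" unfolding g_def by linarith
      with m show ?thesis by linarith
    qed
    have g12: "g (Suc (2 * m)) = m" "g (Suc (Suc (2 * m))) = m" unfolding cls by simp_all
    from cls[of u] consider "u = Suc (2 * m)" | "u = Suc (Suc (2 * m))" by (auto simp: m_def)
    then show thesis
    proof cases
      case 1
      show thesis
        by (rule that(2)[of "Suc (Suc (2 * m))"]) (use 1 m in \<open>simp_all add: cls g12 m_def[symmetric]\<close>)
    next
      case 2
      show thesis
        by (rule that(2)[of "Suc (2 * m)"]) (use 2 m in \<open>auto simp: cls g12 m_def[symmetric]\<close>)
    qed
  qed
  have mono: "g u \<le> g v" if "u \<le> v" for u v using that by (auto simp: g_def intro: div_le_mono)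
  have "n - 3 \<le> gen_edge_connectivity 3 V (multipartite V g)"
  proof (rule gen_edge_connectivity_ge[OF G])
    fix S assume S: "S \<subseteq> V" "card S = 3"
    obtain x y z where xyz: "S = {x, y, z}" "x < y" "y < z" using S(2) by (rule card_3_ordered)
    have V: "x \<in> V" "y \<in> V" "z \<in> V" "finite V" "card V = n" using S xyz by (auto simp: V_def)
    have dist: "distinct [x, y, z]" using xyz by simp
    \<comment> \<open>By \<open>tree_packing_number_multipartite\<close> it suffices to find, within
      \<open>S\<close> and \<open>B\<close>, as many disjoint trees as \<open>B\<close> has
      vertices. The cases follow the classes that \<open>S\<close> meets and whether the mate of
      \<open>z\<close> lies in \<open>V\<close>.\<close>
    have "n \<le> tree_packing_number V (multipartite V g) {x, y, z} + 3"
    proof (cases "z \<le> 2")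
      case True
      have "card V + length ([] :: nat set set list)
        \<le> tree_packing_number V (multipartite V g) {x, y, z} + card ({} :: nat set) + 3"
        by (rule tree_packing_number_multipartite)
          (use V dist xyz(2,3) True in \<open>auto simp: explicit_packing_simps triangle\<close>)
      then show ?thesis using V by simp
    next
      case False
      have "2 < z" using False by simp
      then obtain z' where z': "z' \<noteq> z" "2 < z'" "z' \<le> Suc z"
        "\<And>v. g v = g z \<longleftrightarrow> v = z \<or> v = z'" "\<And>v. g v = g z' \<longleftrightarrow> v = z \<or> v = z'"
        by (rule partner) blast
      show ?thesis
      proof (cases "x \<le> 2")
        case x: True
        show ?thesis
        proof (cases "y \<le> 2")
          case y: True
          \<comment> \<open>The third vertex of the class \<open>{0, 1, 2}\<close>, whose elements
            sum to 3.\<close>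
          define t where "t = 3 - x - y"
          have t: "\<And>v. g v = g x \<longleftrightarrow> v = x \<or> v = y \<or> v = t" "\<And>v. g v = g y \<longleftrightarrow> v = x \<or> v = y \<or> v = t"
              "\<And>v. g v = g t \<longleftrightarrow> v = x \<or> v = y \<or> v = t"
            and t': "t \<in> V" "distinct [x, y, z, t, z']"
            using x y xyz z'(1,2) False n by (auto simp: t_def triangle V_def) presburger+
          show ?thesis
          proof (cases "z' \<in> V")
            case True
            have "card V + length [{{x, z}, {y, z}}, {{z', x}, {z', y}, {z', t}, {t, z}}]
              \<le> tree_packing_number V (multipartite V g) {x, y, z} + card {t, z'} + 3"
              by (rule tree_packing_number_multipartite)
                (use V t' True in \<open>auto simp: explicit_packing_simps t z'(4,5)\<close>)
            then show ?thesis using V t' by simp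
          next
            case no: False
            have "card V + length [{{x, z}, {y, z}}]
              \<le> tree_packing_number V (multipartite V g) {x, y, z} + card {t} + 3"
              by (rule tree_packing_number_multipartite)
                (use V t' no in \<open>auto simp: explicit_packing_simps t z'(4,5)\<close>)
            then show ?thesis using V t' by simp
          qed
        next
          case y: False
          have "2 < y" using y by simp
          then obtain y' where y': "y' \<noteq> y" "2 < y'" "y' \<le> Suc y"
            "\<And>v. g v = g y \<longleftrightarrow> v = y \<or> v = y'" "\<And>v. g v = g y' \<longleftrightarrow> v = y \<or> v = y'"
            by (rule partner) blast
          have y'_V: "y' \<in> V" using y'(3) xyz V by (simp add: V_def)
          \<comment> \<open>\<open>s\<close> and \<open>t\<close> are the two vertices of
            \<open>{0, 1, 2}\<close> other than \<open>x\<close>.\<close>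
          define s where "s = (if x = 0 then 1 else 0 :: nat)"
          define t where "t = 3 - x - s"
          have t: "\<And>v. g v = g x \<longleftrightarrow> v = x \<or> v = s \<or> v = t"
              "\<And>v. g v = g s \<longleftrightarrow> v = x \<or> v = s \<or> v = t"
              "\<And>v. g v = g t \<longleftrightarrow> v = x \<or> v = s \<or> v = t"
            and t': "s \<in> V" "t \<in> V" "distinct [x, y, z, s, t]"
              "x \<notin> {y', z'}" "s \<notin> {y', z'}" "t \<notin> {y', z'}"
            using x y xyz z'(1,2) y'(1,2) n by (auto simp: s_def t_def triangle V_def) presburger+
          show ?thesis
          proof (cases "g y = g z")
            case True
            have cls: "\<And>v. g v = g z \<longleftrightarrow> v = y \<or> v = z" using z'(4)[of y] z'(4) True dist by auto
            have "card V + length [{{x, y}, {y, s}, {s, z}}, {{x, z}, {z, t}, {t, y}}]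
              \<le> tree_packing_number V (multipartite V g) {x, y, z} + card {s, t} + 3"
              by (rule tree_packing_number_multipartite)
                (use V t' in \<open>auto simp: explicit_packing_simps t cls True\<close>)
            then show ?thesis using V t' by simp
          next
            case ne: False
            have "g y' = g y" "g z' = g z" using y'(4)[of y'] z'(4)[of z'] by simp_all
            with ne have "z \<noteq> y'" "y \<noteq> z'" "y' \<noteq> z'" by auto
            then have d: "distinct [x, y, z, s, t, y', z']" using t' y'(1) z'(1) by auto
            show ?thesis
            proof (cases "z' \<in> V")
              case True
              \<comment> \<open>The mate \<open>y'\<close> reaches \<open>x\<close> and
                \<open>z\<close> directly and \<open>y\<close> through \<open>t\<close>;
                \<open>z'\<close> reaches \<open>x\<close> and \<open>y\<close> directly and
                \<open>z\<close> through \<open>t\<close>. The first two trees use the edges within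
                \<open>S\<close> and the vertex \<open>s\<close>.\<close>
              have "card V + length [{{x, y}, {y, z}}, {{x, z}, {z, s}, {s, y}},
                  {{y', x}, {y', z}, {y', t}, {t, y}}, {{z', x}, {z', y}, {z', t}, {t, z}}]
                \<le> tree_packing_number V (multipartite V g) {x, y, z} + card {s, t, y', z'} + 3"
                by (rule tree_packing_number_multipartite)
                  (use V t' True d y'_V in \<open>auto simp: explicit_packing_simps t y'(4,5) z'(4,5)\<close>)
              then show ?thesis using V d by simp
            next
              case no: False
              have "card V + length [{{x, y}, {y, z}}, {{x, z}, {z, s}, {s, y}},
                  {{y', x}, {y', z}, {y', t}, {t, y}}]
                \<le> tree_packing_number V (multipartite V g) {x, y, z} + card {s, t, y'} + 3"
                by (rule tree_packing_number_multipartite)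
                  (use V t' no d y'_V in \<open>auto simp: explicit_packing_simps t y'(4,5) z'(4,5)\<close>)
              then show ?thesis using V d by simp
            qed
          qed
        qed
      next
        case x: False
        have "2 < x" using x by simp
        then obtain x' where x': "x' \<noteq> x" "2 < x'" "x' \<le> Suc x"
          "\<And>v. g v = g x \<longleftrightarrow> v = x \<or> v = x'" "\<And>v. g v = g x' \<longleftrightarrow> v = x \<or> v = x'"
          by (rule partner) blast
        have x'_V: "x' \<in> V" using x'(3) xyz V by (simp add: V_def)
        have "2 < y" using x xyz by simp
        then obtain y' where y': "y' \<noteq> y" "2 < y'" "y' \<le> Suc y"
          "\<And>v. g v = g y \<longleftrightarrow> v = y \<or> v = y'" "\<And>v. g v = g y' \<longleftrightarrow> v = y \<or> v = y'"
          by (rule partner) blast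
        have y'_V: "y' \<in> V" using y'(3) xyz V by (simp add: V_def)
        show ?thesis
        proof (cases "g x = g y \<or> g y = g z")
          case True
          then show ?thesis
          proof
            assume eq: "g x = g y"
            have ne: "g x \<noteq> g z" using eq dist x'(4) z'(4) by (metis distinct_length_2_or_more)
            have "g z' = g z" using z'(4)[of z'] by simp
            then have d: "distinct [x, y, z, z']" using dist z'(1) ne eq by auto
            have "x' = y" using x'(4)[of y] eq dist by auto
            then have cls: "\<And>v. g v = g x \<longleftrightarrow> v = x \<or> v = y" using x'(4) by blast
            \<comment> \<open>Intersecting with \<open>V\<close> covers both positions of
              \<open>z'\<close>: inside \<open>V\<close> it costs one star, outside none.\<close>
            have "card V + length [{{x, z}, {y, z}}]
              \<le> tree_packing_number V (multipartite V g) {x, y, z} + card ({z'} \<inter> V) + 3"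
              by (rule tree_packing_number_multipartite)
                (use V d in \<open>auto simp: explicit_packing_simps cls z'(4,5) eq[symmetric]\<close>)
            moreover have "card ({z'} \<inter> V) \<le> 1" by (cases "z' \<in> V") auto
            ultimately show ?thesis using V by simp
          next
            assume eq: "g y = g z"
            have ne: "g x \<noteq> g z" using eq dist x'(4) z'(4) by (metis distinct_length_2_or_more)
            have "g x' = g x" using x'(4)[of x'] by simp
            then have d: "distinct [x, y, z, x']" using dist x'(1) ne eq by auto
            have cls: "\<And>v. g v = g z \<longleftrightarrow> v = y \<or> v = z" using z'(4)[of y] z'(4) eq dist by auto
            have "card V + length [{{x, y}, {x, z}}]
              \<le> tree_packing_number V (multipartite V g) {x, y, z} + card {x'} + 3"
              by (rule tree_packing_number_multipartite)
                (use V d x'_V in \<open>auto simp: explicit_packing_simps cls x'(4,5) eq\<close>)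
            then show ?thesis using V by simp
          qed
        next
          case ne: False
          \<comment> \<open>The labels increase weakly along \<open>x < y < z\<close>, so with no
            equal neighbours the outer two differ as well.\<close>
          have "g x \<noteq> g z" using ne mono[of x y] mono[of y z] xyz by simp
          moreover have "g x' = g x" "g y' = g y" "g z' = g z"
            using x'(4)[of x'] y'(4)[of y'] z'(4)[of z'] by simp_all
          ultimately have "x \<notin> {y', z'}" "y \<notin> {x', z'}" "z \<notin> {x', y'}" "distinct [x', y', z']"
            using ne by auto
          then have d: "distinct [x, y, z, x', y', z']" using dist x'(1) y'(1) z'(1) by auto
          show ?thesis
          proof (cases "z' \<in> V")
            case True
            \<comment> \<open>Each mate is adjacent to two vertices of \<open>S\<close>, and one
              edge of the triangle on \<open>S\<close> attaches the third.\<close>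
            have "card V + length [{{x', y}, {x', z}, {x, y}}, {{y', x}, {y', z}, {y, z}},
                {{z', x}, {z', y}, {x, z}}]
              \<le> tree_packing_number V (multipartite V g) {x, y, z} + card {x', y', z'} + 3"
              by (rule tree_packing_number_multipartite)
                (use V d True x'_V y'_V in \<open>auto simp: explicit_packing_simps x'(4,5) y'(4,5) z'(4,5)\<close>)
            then show ?thesis using V d by simp
          next
            case no: False
            have "card V + length [{{x', y}, {x', z}, {x, y}}, {{y', x}, {y', z}, {y, z}}]
              \<le> tree_packing_number V (multipartite V g) {x, y, z} + card {x', y'} + 3"
              by (rule tree_packing_number_multipartite)
                (use V d no x'_V y'_V in \<open>auto simp: explicit_packing_simps x'(4,5) y'(4,5) z'(4,5)\<close>)
            then show ?thesis using V d by simp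
          qed
        qed
      qed
    qed
    then show "n - 3 \<le> tree_packing_number V (multipartite V g) S" using xyz by simp
  qed (use n in \<open>auto simp: V_def\<close>)
  then show "n - 3 \<le> gen_edge_connectivity 3 {..<n} (multipartite {..<n} (\<lambda>v. (v - 1) div 2))"
    by (simp add: V_def g_def)
qed


text \<open>The label singles out 0 as the centre. A leaf has degree one, and the whole edge set
  serves as the single connecting set for every \<open>S\<close>.\<close>

lemma gen_edge_connectivity_star:
  fixes n :: nat
  assumes n: "3 \<le> n"
  shows "gen_edge_connectivity 3 {..<n} (multipartite {..<n} (\<lambda>v. v = 0)) = 1"
proof (rule antisym)
  define V where "V = {..<n}"
  define E where "E = multipartite V (\<lambda>v. v = 0)"
  have G: "simple_graph V E" by (simp add: V_def E_def simple_graph_multipartite)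
  have "degree E 1 \<le> card {u \<in> V. (u = 0) \<noteq> (1 = (0 :: nat))}"
    unfolding E_def by (rule degree_multipartite_le) (simp add: V_def)
  also have "{u \<in> V. (u = 0) \<noteq> (1 = (0 :: nat))} = {0}" using n by (auto simp: V_def)
  finally have "gen_edge_connectivity 3 V E \<le> 1"
    using gen_edge_connectivity_le_degree[OF G, of 1] n by (simp add: V_def)
  then show "gen_edge_connectivity 3 {..<n} (multipartite {..<n} (\<lambda>v. v = 0)) \<le> 1"
    by (simp add: E_def V_def)
  have conn: "edge_connects E V"
    unfolding edge_connects_def
  proof (intro allI impI)
    fix X assume X: "edge_closed E X"
    have "v \<in> X \<longleftrightarrow> 0 \<in> X" if "v \<in> V" for v
    proof (cases "v = 0")
      case False
      then have "{0, v} \<in> E" using that n by (simp add: E_def pair_in_multipartite_iff V_def)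
      with X have "{0, v} \<subseteq> X \<or> {0, v} \<inter> X = {}" unfolding edge_closed_def by (rule bspec)
      then show ?thesis by auto
    qed simp
    then show "V \<subseteq> X \<or> V \<inter> X = {}" by blast
  qed
  have "1 \<le> gen_edge_connectivity 3 V E"
  proof (rule gen_edge_connectivity_ge[OF G])
    fix S assume S: "S \<subseteq> V" "card S = 3"
    have "length [E] \<le> tree_packing_number V E S"
      using S edge_connects_subset[OF conn] by (intro length_le_tree_packing_number[OF G]) auto
    then show "1 \<le> tree_packing_number V E S" by simp
  qed (use n in \<open>auto simp: V_def\<close>)
  then show "1 \<le> gen_edge_connectivity 3 {..<n} (multipartite {..<n} (\<lambda>v. v = 0))"
    by (simp add: E_def V_def)
qed

text \<open>This graph makes both estimates in \<open>card_edges_ge\<close> equalities: the part of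
  six vertices is independent of degree 5 and meets all edges, and the other part has degree
  6.\<close>

lemma gen_edge_connectivity_K_5_6:
  "gen_edge_connectivity 3 {..<11} (multipartite {..<11} (\<lambda>v. v < (5 :: nat))) = 5"
proof (rule antisym)
  define V where "V = {..<11 :: nat}"
  define g where "g = (\<lambda>v. v < (5 :: nat))"
  have G: "simple_graph V (multipartite V g)" by (simp add: V_def simple_graph_multipartite)
  have "degree (multipartite V g) 5 \<le> card {u \<in> V. g u \<noteq> g 5}"
    by (rule degree_multipartite_le) (simp add: V_def)
  also have "{u \<in> V. g u \<noteq> g 5} = {..<5}" by (auto simp: V_def g_def)
  finally show "gen_edge_connectivity 3 {..<11} (multipartite {..<11} (\<lambda>v. v < (5 :: nat))) \<le> 5"
    using gen_edge_connectivity_le_degree[OF G, of 5] by (simp add: V_def g_def)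
  have "5 \<le> gen_edge_connectivity 3 V (multipartite V g)"
  proof (rule gen_edge_connectivity_ge[OF G])
    fix S assume S: "S \<subseteq> V" "card S = 3"
    obtain x y z where xyz: "S = {x, y, z}" "x < y" "y < z" using S(2) by (rule card_3_ordered)
    have V: "x \<in> V" "y \<in> V" "z \<in> V" "finite V" "card V = 11" using S xyz by (auto simp: V_def)
    have dist: "distinct [x, y, z]" using xyz by simp
    define A where "A = {..<5} - S"
    define B where "B = {5..<11} - S"
    have fin: "finite A" "finite B" by (auto simp: A_def B_def)
    have disj: "A \<inter> B = {}" "x \<notin> A \<union> B" "y \<notin> A \<union> B" "z \<notin> A \<union> B"
      by (auto simp: A_def B_def xyz(1))
    \<comment> \<open>The case names count the vertices of \<open>S\<close> in the part
      \<open>{..<5}\<close>. When \<open>S\<close> lies in one part, the stars centred in the other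
      part suffice.\<close>
    consider (3) "z < 5" | (2) "y < 5" "5 \<le> z" | (1) "x < 5" "5 \<le> y" | (0) "5 \<le> x" by linarith
    then have "5 \<le> tree_packing_number V (multipartite V g) {x, y, z}"
    proof cases
      case 3
      have "card V + length ([] :: nat set set list) \<le> tree_packing_number V (multipartite V g) {x, y, z} + card A + 3"
        by (rule tree_packing_number_multipartite)
          (use V dist 3 xyz in \<open>auto simp: A_def V_def g_def\<close>)
      moreover have "card A = 2"
        unfolding A_def using 3 xyz V by (subst card_Diff_subset) auto
      ultimately show ?thesis using V by simp
    next
      case 0
      have "card V + length ([] :: nat set set list) \<le> tree_packing_number V (multipartite V g) {x, y, z} + card B + 3"
        by (rule tree_packing_number_multipartite)
          (use V dist 0 xyz in \<open>auto simp: B_def V_def g_def\<close>)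
      moreover have "card B = 3"
        unfolding B_def using 0 xyz V by (subst card_Diff_subset) (auto simp: V_def)
      ultimately show ?thesis using V by simp
    next
      case 2
      have AB: "{..<5} - {x, y} = A" "{5..<11} - {z} = B" using 2 xyz by (auto simp: A_def B_def)
      have "card A = 3" "card B = 5"
        unfolding AB[symmetric] using 2 xyz V by (auto simp: card_Diff_subset V_def)
      then obtain as bs where as: "set as = A" "length as = 3" "distinct as"
        and bs: "set bs = B" "length bs = 5" "distinct bs"
        using finite_distinct_list[OF fin(1)] finite_distinct_list[OF fin(2)] distinct_card by metis
      obtain a b c where abc: "as = [a, b, c]" using as(2) by (auto simp: numeral_eq_Suc length_Suc_conv)
      obtain p q r s t where pqrst: "bs = [p, q, r, s, t]"
        using bs(2) by (auto simp: numeral_eq_Suc length_Suc_conv)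
      have "distinct ([x, y, z] @ as @ bs)"
        using dist as(3) bs(3) disj by (simp add: as(1) bs(1))
      then have d: "distinct [x, y, z, a, b, c, p, q, r, s, t]" by (simp add: abc pqrst)
      have "\<forall>v\<in>set as. g v" "\<forall>v\<in>set bs. \<not> g v" "g x" "g y" "\<not> g z"
        using as(1) bs(1) 2 xyz(2,3) by (auto simp: A_def B_def g_def)
      then have g: "g a" "g b" "g c"
        "\<not> g p" "\<not> g q" "\<not> g r" "\<not> g s" "\<not> g t" "g x" "g y" "\<not> g z" by (simp_all add: abc pqrst)
      let ?B = "{a, b, c, p, q, r, s, t}"
      have "V - {x, y, z} = set as \<union> set bs"
        unfolding as(1) bs(1) by (auto simp: V_def A_def B_def xyz(1))
      then have VB: "V - {x, y, z} = ?B" by (simp add: abc pqrst insert_commute)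
      \<comment> \<open>The five neighbours of \<open>z\<close> are \<open>x\<close>,
        \<open>y\<close>, \<open>a\<close>, \<open>b\<close>, \<open>c\<close>; each tree takes one
        edge at \<open>z\<close> and joins \<open>x\<close> and \<open>y\<close> through its own
        vertex of the larger part.\<close>
      let ?Fs = "[{{z, x}, {x, p}, {p, y}}, {{z, y}, {y, q}, {q, x}},
          {{z, a}, {a, r}, {r, x}, {r, y}}, {{z, b}, {b, s}, {s, x}, {s, y}},
          {{z, c}, {c, t}, {t, x}, {t, y}}]"
      have trees: "\<forall>F\<in>set ?Fs. F \<subseteq> multipartite ({x, y, z} \<union> ?B) g \<and> edge_connects F {x, y, z}"
        using g by (simp add: explicit_packing_simps) blast
      have "card V + length ?Fs
        \<le> tree_packing_number V (multipartite V g) {x, y, z} + card ?B + 3"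
      proof (rule tree_packing_number_multipartite)
        show "sorted_wrt (\<lambda>A B. A \<inter> B = {}) ?Fs" using d by (auto simp: doubleton_eq_iff)
      qed (use V dist VB bspec[OF trees] in auto)
      then show ?thesis using V d by simp
    next
      case 1
      have AB: "{..<5} - {x} = A" "{5..<11} - {y, z} = B" using 1 xyz by (auto simp: A_def B_def)
      have "card A = 4" "card B = 4"
        unfolding AB[symmetric] using 1 xyz V by (auto simp: card_Diff_subset V_def)
      then obtain as bs where as: "set as = A" "length as = 4" "distinct as"
        and bs: "set bs = B" "length bs = 4" "distinct bs"
        using finite_distinct_list[OF fin(1)] finite_distinct_list[OF fin(2)] distinct_card by metis
      obtain a b c e where abce: "as = [a, b, c, e]"
        using as(2) by (auto simp: numeral_eq_Suc length_Suc_conv)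
      obtain p q r s where pqrs: "bs = [p, q, r, s]"
        using bs(2) by (auto simp: numeral_eq_Suc length_Suc_conv)
      have "distinct ([x, y, z] @ as @ bs)"
        using dist as(3) bs(3) disj by (simp add: as(1) bs(1))
      then have d: "distinct [x, y, z, a, b, c, e, p, q, r, s]" by (simp add: abce pqrs)
      have "\<forall>v\<in>set as. g v" "\<forall>v\<in>set bs. \<not> g v" "g x" "\<not> g y" "\<not> g z"
        using as(1) bs(1) 1 xyz(2,3) by (auto simp: A_def B_def g_def)
      then have g: "g a" "g b" "g c" "g e"
        "\<not> g p" "\<not> g q" "\<not> g r" "\<not> g s" "g x" "\<not> g y" "\<not> g z" by (simp_all add: abce pqrs)
      let ?B = "{a, b, c, e, p, q, r, s}"
      have "V - {x, y, z} = set as \<union> set bs"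
        unfolding as(1) bs(1) by (auto simp: V_def A_def B_def xyz(1))
      then have VB: "V - {x, y, z} = ?B" by (simp add: abce pqrs insert_commute)
      \<comment> \<open>Each tree is built on one of the five common neighbours of \<open>y\<close>
        and \<open>z\<close>; those other than \<open>x\<close> reach \<open>x\<close> by a detour
        through a vertex of the larger part.\<close>
      let ?Fs = "[{{x, y}, {x, z}},
          {{a, y}, {a, z}, {a, p}, {p, x}}, {{b, y}, {b, z}, {b, q}, {q, x}},
          {{c, y}, {c, z}, {c, r}, {r, x}}, {{e, y}, {e, z}, {e, s}, {s, x}}]"
      have trees: "\<forall>F\<in>set ?Fs. F \<subseteq> multipartite ({x, y, z} \<union> ?B) g \<and> edge_connects F {x, y, z}"
        using g by (simp add: explicit_packing_simps) blast
      have "card V + length ?Fs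
        \<le> tree_packing_number V (multipartite V g) {x, y, z} + card ?B + 3"
      proof (rule tree_packing_number_multipartite)
        show "sorted_wrt (\<lambda>A B. A \<inter> B = {}) ?Fs" using d by (auto simp: doubleton_eq_iff)
      qed (use V dist VB bspec[OF trees] in auto)
      then show ?thesis using V d by simp
    qed
    then show "5 \<le> tree_packing_number V (multipartite V g) S" using xyz by simp
  qed (auto simp: V_def)
  then show "5 \<le> gen_edge_connectivity 3 {..<11} (multipartite {..<11} (\<lambda>v. v < (5 :: nat)))"
    by (simp add: V_def g_def)
qed

section \<open>The minimum sizes\<close>

text \<open>The edges of the extremal graph are not counted directly: an exhibited non-edge bounds
  their number above, and the general lower bound, applied to this very graph, bounds it
  below.\<close>

lemma min_size_n_minus_2:
  assumes n: "3 \<le> n"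
  shows "Suc (min_size n 3 (n - 2)) = n choose 2"
proof -
  let ?V = "{..<n}" and ?E = "multipartite {..<n} (\<lambda>v. v - 1)"
  note gec = gen_edge_connectivity_almost_complete[OF n]
  have G: "simple_graph ?V ?E" by (simp add: simple_graph_multipartite)
  have bound: "n choose 2 \<le> card E + 1"
    if "simple_graph V E" "card V = n" "gen_edge_connectivity 3 V E = n - 2" for V :: "nat set" and E
    using card_complement_le_1[of V E] card_complement[of V E] that n by simp
  have "{0, 1} \<in> all_pairs ?V - ?E" using n by (simp add: pair_in_all_pairs_iff pair_in_multipartite_iff)
  then have "0 < card (all_pairs ?V - ?E)" by (subst card_gt_0_iff) (auto simp: finite_all_pairs)
  then have card: "Suc (card ?E) = n choose 2"
    using card_complement[OF G] bound[OF G _ gec] by simp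
  have "min_size n 3 (n - 2) = card ?E"
    by (rule min_size_eqI[OF G _ gec]) (use bound card in fastforce)+
  then show ?thesis using card by simp
qed

lemma min_size_n_minus_3:
  assumes n: "3 \<le> n"
  shows "min_size n 3 (n - 3) + (n + 3) div 2 = n choose 2"
proof -
  let ?V = "{..<n}" and ?E = "multipartite {..<n} (\<lambda>v. (v - 1) div 2)"
  note gec = gen_edge_connectivity_triangle_matching_complement[OF n]
  have G: "simple_graph ?V ?E" by (simp add: simple_graph_multipartite)
  have bound: "n choose 2 \<le> card E + (n + 3) div 2"
    if "simple_graph V E" "card V = n" "gen_edge_connectivity 3 V E = n - 3" for V :: "nat set" and E
    using card_complement_le[OF that(1)] card_complement[OF that(1)] that(2,3) n by simp
  \<comment> \<open>\<open>i = 0\<close> gives \<open>{1, 2}\<close>, which completes the triangle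
    on 0, 1, 2; the other pairs form the matching. Together with the two edges at 0 these are
    \<open>(n + 3) div 2\<close> non-edges.\<close>
  let ?M = "(\<lambda>i. {2 * i + 1, 2 * i + 2}) ` {..<(n - 1) div 2}"
  have "{{0, 1}, {0, 2}} \<union> ?M \<subseteq> all_pairs ?V - ?E"
    using n by (auto simp: pair_in_all_pairs_iff pair_in_multipartite_iff)
  then have "card ({{0, 1}, {0, 2}} \<union> ?M) \<le> card (all_pairs ?V - ?E)"
    by (intro card_mono) (auto simp: finite_all_pairs)
  moreover have "card ({{0, 1}, {0, 2 :: nat}} \<union> ?M) = 2 + (n - 1) div 2"
  proof (subst card_Un_disjoint)
    have "inj_on (\<lambda>i. {2 * i + 1, 2 * i + 2 :: nat}) {..<(n - 1) div 2}"
      by (auto simp: inj_on_def doubleton_eq_iff)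
    moreover have "card {{0, 1}, {0, 2 :: nat}} = 2" by (simp add: doubleton_eq_iff)
    ultimately show "card {{0, 1}, {0, 2 :: nat}} + card ?M = 2 + (n - 1) div 2"
      by (simp add: card_image)
  qed (auto simp: doubleton_eq_iff)
  ultimately have card: "card ?E + (n + 3) div 2 = n choose 2"
    using card_complement[OF G] bound[OF G _ gec] n by simp
  have "min_size n 3 (n - 3) = card ?E"
    by (rule min_size_eqI[OF G _ gec]) (use bound card in fastforce)+
  then show ?thesis using card by simp
qed

lemma min_size_1:
  assumes n: "3 \<le> n"
  shows "min_size n 3 1 = n - 1"
proof -
  let ?V = "{..<n}" and ?E = "multipartite {..<n} (\<lambda>v. v = 0)"
  note gec = gen_edge_connectivity_star[OF n]
  have G: "simple_graph ?V ?E" by (simp add: simple_graph_multipartite)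
  have bound: "n - 1 \<le> card E"
    if "simple_graph V E" "card V = n" "gen_edge_connectivity 3 V E = 1" for V :: "nat set" and E
    \<comment> \<open>The value 1 rules out disconnected graphs, on which the connectivity is 0 by
      definition.\<close>
    using graph_connected_card_le[of V E] that
    by (cases "graph_connected V E") (auto simp: gen_edge_connectivity_def)
  have "?E \<subseteq> (\<lambda>v. {0, v}) ` {1..<n}" by (auto simp: multipartite_def)
  then have "card ?E \<le> card {1..<n}" by (intro surj_card_le) auto
  then have card: "card ?E = n - 1" using bound[OF G _ gec] by simp
  show ?thesis by (rule min_size_eqI[OF G _ gec card]) (use bound in auto)
qed

lemma card_edges_ge_ceiling:
  assumes "simple_graph V E" "3 \<le> card V" "gen_edge_connectivity 3 V E = l"
  shows "\<lceil>real l * (real l + 1) / (2 * real l + 1) * real (card V)\<rceil> \<le> int (card E)"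
proof -
  have "real (l * (l + 1) * card V) \<le> real ((2 * l + 1) * card E)"
    using card_edges_ge[OF assms] by (simp only: of_nat_le_iff)
  then have "real l * (real l + 1) * real (card V) \<le> real (card E) * (2 * real l + 1)"
    by (simp add: algebra_simps)
  then have "real l * (real l + 1) / (2 * real l + 1) * real (card V) \<le> real (card E)"
    by (simp add: pos_divide_le_eq)
  then show ?thesis by (simp add: ceiling_le_iff)
qed

text \<open>A subgraph of the complete graph minus an edge with connectivity exactly
  \<open>l\<close> shows that the minimum is attained, so the edge bound applies to a
  minimizer.\<close>

lemma min_size_ge:
  assumes n: "3 \<le> n" and l: "l \<le> n - 2"
  shows "\<lceil>real l * (real l + 1) / (2 * real l + 1) * real n\<rceil> \<le> int (min_size n 3 l)"
proof -
  have "simple_graph {..<n} (multipartite {..<n} (\<lambda>v. v - 1))"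
    by (simp add: simple_graph_multipartite)
  then obtain E where E: "simple_graph {..<n} E" "gen_edge_connectivity 3 {..<n} E = l"
    using ex_subgraph_with_gen_edge_connectivity[of "{..<n}" _ l]
      gen_edge_connectivity_almost_complete[OF n] n l by (metis card_lessThan)
  obtain V' :: "nat set" and E' where "simple_graph V' E'" "card V' = n"
    "gen_edge_connectivity 3 V' E' = l" "card E' = min_size n 3 l"
    using min_size_attained[OF E(1) _ E(2)] by (metis card_lessThan)
  then show ?thesis using card_edges_ge_ceiling[of V' E' l] n by simp
qed

text \<open>Here \<open>n = 2 * l + 1\<close>, so this factor cancels in
  \<open>card_edges_ge\<close> and leaves \<open>l * (l + 1) = 30\<close>, the product of the two
  part sizes 5 and 6.\<close>

lemma min_size_11_5: "min_size 11 3 5 = 30"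
proof -
  let ?V = "{..<11 :: nat}" and ?E = "multipartite {..<11} (\<lambda>v. v < (5 :: nat))"
  note gec = gen_edge_connectivity_K_5_6
  have G: "simple_graph ?V ?E" by (simp add: simple_graph_multipartite)
  have bound: "30 \<le> card E"
    if "simple_graph V E" "card V = 11" "gen_edge_connectivity 3 V E = 5" for V :: "nat set" and E
    using card_edges_ge[OF that(1) _ that(3)] that(2) by simp
  have "?E \<subseteq> (\<lambda>(u, v). {u, v}) ` ({..<5} \<times> {5..<11})"
    by (fastforce simp: multipartite_def doubleton_eq_iff image_iff)
  then have "card ?E \<le> card ({..<5 :: nat} \<times> {5..<11 :: nat})" by (intro surj_card_le) auto
  then have card: "card ?E = 30" using bound[OF G _ gec] by simp
  show ?thesis by (rule min_size_eqI[OF G _ gec card]) (use bound in auto)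
qed

theorem theorem3:
  shows "(\<forall>n\<ge>3. int (min_size n 3 (n - 2)) = int (n choose 2) - 1) \<and>
         (\<forall>n\<ge>3. int (min_size n 3 (n - 3)) = int (n choose 2) - \<lfloor>(real n + 3) / 2\<rfloor>) \<and>
         (\<forall>n\<ge>3. int (min_size n 3 1) = int n - 1) \<and>
         (\<forall>n l. 11 \<le> n \<and> 1 \<le> l \<and> l \<le> n - 4 \<longrightarrow>
            \<lceil>real l * (real l + 1) / (2 * real l + 1) * real n\<rceil> \<le> int (min_size n 3 l)) \<and>
         (\<exists>n l. 11 \<le> n \<and> 1 \<le> l \<and> l \<le> n - 4 \<and>
            int (min_size n 3 l) = \<lceil>real l * (real l + 1) / (2 * real l + 1) * real n\<rceil>)"
proof (intro conjI allI impI)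
  fix n :: nat assume n: "3 \<le> n"
  show "int (min_size n 3 (n - 2)) = int (n choose 2) - 1"
    using min_size_n_minus_2[OF n] by linarith
  have "\<lfloor>(real n + 3) / 2\<rfloor> = int ((n + 3) div 2)"
    using floor_divide_of_nat_eq[of "n + 3" 2, where ?'a = real] by simp
  then show "int (min_size n 3 (n - 3)) = int (n choose 2) - \<lfloor>(real n + 3) / 2\<rfloor>"
    using min_size_n_minus_3[OF n] by linarith
  show "int (min_size n 3 1) = int n - 1" using min_size_1[OF n] n by simp
next
  fix n l :: nat assume "11 \<le> n \<and> 1 \<le> l \<and> l \<le> n - 4"
  then show "\<lceil>real l * (real l + 1) / (2 * real l + 1) * real n\<rceil> \<le> int (min_size n 3 l)"
    by (intro min_size_ge) auto
next
  show "\<exists>n l. 11 \<le> n \<and> 1 \<le> l \<and> l \<le> n - 4 \<and>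
    int (min_size n 3 l) = \<lceil>real l * (real l + 1) / (2 * real l + 1) * real n\<rceil>"
    by (intro exI[of _ 11] exI[of _ 5]) (simp add: min_size_11_5)
qed

end
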